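(* Let $\mathbb{R}^n$ and $\mathbb{R}^m$ be equipped with Euclidean norms. Let $\mu\in\mathcal{W}(\mathbb{R}^n,\mathbb{R}^m)$ and let $u\colon\mathbb{R}^n\to\mathbb{R}^m$ be an optimal potential for $\mu$. Suppose that there exists an optimal transport $\pi$ of $\mu$ such that $$\mathrm{P}_1\|\pi\|\ll\lambda\quad\text{and}\quad \mathrm{P}_2\|\pi\| \ll\lambda,$$ where $\lambda$ is the Lebesgue measure on $\mathbb{R}^n$. Then for any transport set $A$ associated with $u$: (i) $\mu(A)=0$; (ii) $\pi|_{A\times A}\in \Gamma(\mu|_A)$ and $\pi|_{A\times A}$ is an optimal transport of $\mu|_A$; (iii) $u$ is an optimal potential of $\mu|_A$.
   Context: $\langle\cdot,\cdot\rangle$ is the standard scalar product. For an $\mathbb{R}^m$-valued Borel measure $\mu$, $\|\mu\|$ denotes its total variation measure, and $\int\langle u,d\mu\rangle=\sum_{i=1}^m\int u_i\,d\mu_i$. For a (real- or $\mathbb{R}^m$-valued) Borel measure $\pi$ on $\mathbb{R}^n\times \mathbb{R}^n$, its marginals are $\mathrm{P}_1\pi(B)=\pi(B\times \mathbb{R}^n)$ and $\mathrm{P}_2\pi(B)=\pi(\mathbb{R}^n\times B)$ for Borel $B\subset\mathbb{R}^n$. $\Gamma(\mu)$ is the set of all $\mathbb{R}^m$-valued Borel measures $\pi$ on $\mathbb{R}^n\times\mathbb{R}^n$ with $\mathrm{P}_1\pi-\mathrm{P}_2\pi=\mu$. Restrictions are $\mu|_A(B)=\mu(A\cap B)$ and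 $\pi|_{A\times A}(C)=\pi(C\cap (A\times A))$. The Wasserstein space $\mathcal{W}(\mathbb{R}^n,\mathbb{R}^m)$ is the space of all $\mathbb{R}^m$-valued Borel measures $\mu$ on $\mathbb{R}^n$ with $\mu(\mathbb{R}^n)=0$ and $\int \|x-x_0\|\,d\|\mu\|(x)<\infty$ for some $x_0\in\mathbb{R}^n$, with the norm $\|\mu\|_{\mathcal{W}(\mathbb{R}^n,\mathbb{R}^m)}=\inf\{\int\|x-y\|\,d\|\pi\|(x,y)\mid \pi\in\Gamma(\mu)\}$. A $1$-Lipschitz map $u\colon \mathbb{R}^n\to\mathbb{R}^m$ is an optimal potential of $\mu$ if $\int\langle u,d\mu\rangle=\sup\{\int\langle v,d\mu\rangle\mid v\colon \mathbb{R}^n\to\mathbb{R}^m\text{ is }1\text{-Lipschitz}\}$. A measure $\pi\in\Gamma(\mu)$ is an optimal transport of $\mu$ if $\|\mu\|_{\mathcal{W}(\mathbb{R}^n,\mathbb{R}^m)}=\int\|x-y\|\,d\|\pi\|(x,y)$. A leaf of a $1$-Lipschitz map $u\colon\mathbb{R}^n\to\mathbb{R}^m$ is a set $\mathcal{S}\subset\mathbb{R}^n$, maximal with respect to inclusion, such that $u|_{\mathcal{S}}$ is an isometry, i.e. $\|u(x)-u(y)\|=\|x-y\|$ for all $x,y\in\mathcal{S}$. A Borel set $A\subset\mathbb{R}^n$ is a transport set associated with $u$ if: whenever $x\in A$ is contained in a unique leaf of $u$ and $y\in\mathbb{R}^n$ satisfies $\|u(x)-u(y)\|=\|x-y\|$,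 then $y\in A$. *)

theory Defs
  imports "HOL-Analysis.Analysis"
begin

text \<open>A vector-valued Borel measure is represented by a set function; only its values on Borel
  sets are meaningful. Countable additivity forces the value on the empty set to be zero, since
  a constant sequence is summable only if it vanishes.\<close>

definition vector_measure :: "('a::topological_space set \<Rightarrow> 'b::real_normed_vector) \<Rightarrow> bool" where
  "vector_measure \<mu> \<longleftrightarrow>
     (\<forall>E :: nat \<Rightarrow> 'a set. range E \<subseteq> sets borel \<longrightarrow> disjoint_family E \<longrightarrow>
        (\<lambda>i. \<mu> (E i)) sums \<mu> (\<Union>i. E i))"

text \<open>For a vector measure the set functions passed to \<^const>\<open>measure_of\<close> below are countably
  additive, so \<^const>\<open>measure_of\<close> does not fall back to the null measure.\<close>

definition total_variation ::
  "('a::topological_space set \<Rightarrow> 'b::real_normed_vector) \<Rightarrow> 'a measure" where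
  "total_variation \<mu> = measure_of UNIV (sets borel)
     (\<lambda>B. SUP E \<in> {E :: nat \<Rightarrow> 'a set. range E \<subseteq> sets borel \<and> disjoint_family E \<and> (\<Union>i. E i) = B}.
            (\<Sum>i. ennreal (norm (\<mu> (E i)))))"

text \<open>Positive part of the Jordan decomposition of a real-valued measure; the truncation of
  negative values by \<^const>\<open>ennreal\<close> is harmless because the empty set contributes zero.\<close>

definition positive_part :: "('a::topological_space set \<Rightarrow> real) \<Rightarrow> 'a measure" where
  "positive_part \<nu> = measure_of UNIV (sets borel)
     (\<lambda>B. SUP C \<in> {C \<in> sets borel. C \<subseteq> B}. ennreal (\<nu> C))"

definition signed_integral :: "('a::topological_space set \<Rightarrow> real) \<Rightarrow> ('a \<Rightarrow> real) \<Rightarrow> real" where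
  "signed_integral \<nu> f =
     integral\<^sup>L (positive_part \<nu>) f - integral\<^sup>L (positive_part (\<lambda>B. - \<nu> B)) f"

definition vector_integral ::
  "('a::topological_space set \<Rightarrow> real ^ 'm) \<Rightarrow> ('a \<Rightarrow> real ^ 'm) \<Rightarrow> real" where
  "vector_integral \<mu> u = (\<Sum>i\<in>UNIV. signed_integral (\<lambda>B. \<mu> B $ i) (\<lambda>x. u x $ i))"

definition measure_restriction :: "('a set \<Rightarrow> 'b) \<Rightarrow> 'a set \<Rightarrow> ('a set \<Rightarrow> 'b)" where
  "measure_restriction \<mu> A = (\<lambda>B. \<mu> (B \<inter> A))"

definition marginal1 :: "(('a \<times> 'c) set \<Rightarrow> 'b) \<Rightarrow> ('a set \<Rightarrow> 'b)" where
  "marginal1 \<pi> = (\<lambda>B. \<pi> (B \<times> UNIV))"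

definition marginal2 :: "(('a \<times> 'c) set \<Rightarrow> 'b) \<Rightarrow> ('c set \<Rightarrow> 'b)" where
  "marginal2 \<pi> = (\<lambda>B. \<pi> (UNIV \<times> B))"

definition transports :: "((real ^ 'n) set \<Rightarrow> real ^ 'm) \<Rightarrow>
    (((real ^ 'n) \<times> (real ^ 'n)) set \<Rightarrow> real ^ 'm) set" where
  "transports \<mu> = {\<pi>. vector_measure \<pi> \<and>
     (\<forall>B\<in>sets borel. marginal1 \<pi> B - marginal2 \<pi> B = \<mu> B)}"

definition wasserstein_space :: "((real ^ 'n) set \<Rightarrow> real ^ 'm) set" where
  "wasserstein_space = {\<mu>. vector_measure \<mu> \<and> \<mu> UNIV = 0 \<and>
     (\<exists>x0. (\<integral>\<^sup>+x. ennreal (norm (x - x0)) \<partial>total_variation \<mu>) < \<infinity>)}"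

definition transport_cost :: "(((real ^ 'n) \<times> (real ^ 'n)) set \<Rightarrow> real ^ 'm) \<Rightarrow> ennreal" where
  "transport_cost \<pi> = (\<integral>\<^sup>+z. ennreal (norm (fst z - snd z)) \<partial>total_variation \<pi>)"

text \<open>The cost of a transport may be infinite, hence the norm takes extended values; it is finite
  on \<^const>\<open>wasserstein_space\<close>.\<close>

definition wasserstein_norm :: "((real ^ 'n) set \<Rightarrow> real ^ 'm) \<Rightarrow> ennreal" where
  "wasserstein_norm \<mu> = (INF \<pi> \<in> transports \<mu>. transport_cost \<pi>)"

definition optimal_transport :: "((real ^ 'n) set \<Rightarrow> real ^ 'm) \<Rightarrow>
    (((real ^ 'n) \<times> (real ^ 'n)) set \<Rightarrow> real ^ 'm) \<Rightarrow> bool" where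
  "optimal_transport \<mu> \<pi> \<longleftrightarrow> \<pi> \<in> transports \<mu> \<and> wasserstein_norm \<mu> = transport_cost \<pi>"

text \<open>The supremum is taken in the extended reals, where it is never a junk value.\<close>

definition optimal_potential :: "((real ^ 'n) set \<Rightarrow> real ^ 'm) \<Rightarrow>
    (real ^ 'n \<Rightarrow> real ^ 'm) \<Rightarrow> bool" where
  "optimal_potential \<mu> u \<longleftrightarrow> 1-lipschitz_on UNIV u \<and>
     ereal (vector_integral \<mu> u) =
       (SUP v \<in> {v :: real ^ 'n \<Rightarrow> real ^ 'm. 1-lipschitz_on UNIV v}. ereal (vector_integral \<mu> v))"

definition isometric_on :: "(real ^ 'n) set \<Rightarrow> (real ^ 'n \<Rightarrow> real ^ 'm) \<Rightarrow> bool" where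
  "isometric_on S u \<longleftrightarrow> (\<forall>x\<in>S. \<forall>y\<in>S. norm (u x - u y) = norm (x - y))"

definition leaf :: "(real ^ 'n \<Rightarrow> real ^ 'm) \<Rightarrow> (real ^ 'n) set \<Rightarrow> bool" where
  "leaf u S \<longleftrightarrow> isometric_on S u \<and> (\<forall>T. S \<subseteq> T \<and> isometric_on T u \<longrightarrow> T = S)"

definition transport_set :: "(real ^ 'n \<Rightarrow> real ^ 'm) \<Rightarrow> (real ^ 'n) set \<Rightarrow> bool" where
  "transport_set u A \<longleftrightarrow> A \<in> sets borel \<and>
     (\<forall>x\<in>A. (\<exists>!S. leaf u S \<and> x \<in> S) \<longrightarrow>
        (\<forall>y. norm (u x - u y) = norm (x - y) \<longrightarrow> y \<in> A))"

end

theory Submission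
  imports Defs
begin

text \<open>Let \<open>\<pi>\<close> be a transport of \<open>\<mu>\<close> and \<open>v\<close> a 1-Lipschitz map. Since \<open>\<mu>\<close> is the difference of the marginals
  of \<open>\<pi>\<close>, the integral of \<open>v\<close> against \<open>\<mu>\<close> equals that of \<open>v x - v y\<close> against \<open>\<pi>\<close>, so it is at most the
  cost of \<open>\<pi>\<close> (\<open>pairing_le_cost\<close>). By Hahn--Banach duality there is no gap: the supremum over \<open>v\<close> is the
  Wasserstein norm (\<open>wasserstein_duality\<close>). Write \<open>\<pi>\<close> as a density \<open>k\<close>, with values in the unit ball, against its
  total variation. For an optimal potential \<open>u\<close> and an optimal transport \<open>\<pi>\<close>, the inequality
  \<open>(u x - u y) \<bullet> k (x, y) \<le> norm (u x - u y) \<le> norm (x - y)\<close> must therefore be an equality for almost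
  every pair \<open>(x, y)\<close>. In particular, almost every pair has its distance preserved by \<open>u\<close>.

  The points that lie on several leaves of \<open>u\<close> form a Lebesgue null set (\<open>isometric_branching_null\<close>). As
  both marginals are absolutely continuous, almost every pair \<open>(x, y)\<close> consists of points on single leaves. So
  if one of \<open>x\<close>, \<open>y\<close> belongs to the transport set \<open>A\<close>, then so does the other: \<open>\<pi>\<close> charges neither
  \<open>A \<times> - A\<close> nor \<open>- A \<times> A\<close>. It follows that the restriction of \<open>\<pi>\<close> to \<open>A \<times> A\<close> transports the restriction of
  \<open>\<mu>\<close> to \<open>A\<close>, which hence has total mass zero. The pointwise equality survives the restriction, so the
  integral of \<open>u\<close> against the restricted measure equals the cost of the restricted transport, and weak duality
  makes both of them optimal.

  For duality, Hahn--Banach is applied to finitely supported measures only, on which a dominated functional is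
  visibly the integration of a 1-Lipschitz map (\<open>discrete_duality\<close>). The general case follows by
  pushing \<open>\<mu>\<close> forward under maps with finitely many values.

  The null set is found by a translation argument. At a point on several leaves, \<open>u\<close>
  is affine with slope one along two segments and strictly decreases the angle between them. A set of
  points at which this happens with nearly the same directions misses its own short translates along one
  of them (\<open>nearly_affine_null\<close>), and such a set is null.\<close>

section \<open>Vector measures and their total variation\<close>

lemma vector_measure_sums:
  assumes "vector_measure \<nu>" "range E \<subseteq> sets borel" "disjoint_family E"
  shows "(\<lambda>i. \<nu> (E i)) sums \<nu> (\<Union>i. E i)"
  using assms unfolding vector_measure_def by blast

lemma vector_measure_empty:
  assumes "vector_measure \<nu>"
  shows "\<nu> {} = 0"
proof -
  have "(\<lambda>i::nat. \<nu> {}) sums \<nu> {}"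
    using vector_measure_sums[OF assms, of "\<lambda>_. {}"] by (simp add: disjoint_family_on_def)
  hence "(\<lambda>i::nat. \<nu> {}) \<longlonglongrightarrow> 0" by (rule sums_summable[THEN summable_LIMSEQ_zero])
  thus ?thesis by (simp add: LIMSEQ_const_iff)
qed

lemma disjoint_family_binaryset: "A \<inter> B = {} \<Longrightarrow> disjoint_family (binaryset A B)"
  by (simp add: disjoint_family_on_def binaryset_def Int_commute)

lemma vector_measure_Un:
  assumes \<nu>: "vector_measure \<nu>" and "A \<in> sets borel" "B \<in> sets borel" "A \<inter> B = {}"
  shows "\<nu> (A \<union> B) = \<nu> A + \<nu> B"
proof -
  have "(\<lambda>i. \<nu> (binaryset A B i)) sums \<nu> (A \<union> B)"
    using vector_measure_sums[OF \<nu>, of "binaryset A B"] assms disjoint_family_binaryset[of A B]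
    by (simp add: range_binaryset_eq UN_binaryset_eq)
  moreover have "(\<lambda>i. \<nu> (binaryset A B i)) sums (\<nu> A + \<nu> B)"
    by (rule binaryset_sums) (rule vector_measure_empty[OF \<nu>])
  ultimately show ?thesis by (rule sums_unique2)
qed

lemma vector_measure_Diff:
  assumes "vector_measure \<nu>" "A \<in> sets borel" "B \<in> sets borel" "B \<subseteq> A"
  shows "\<nu> (A - B) = \<nu> A - \<nu> B"
proof -
  have "\<nu> ((A - B) \<union> B) = \<nu> (A - B) + \<nu> B"
    using assms by (intro vector_measure_Un) auto
  also have "(A - B) \<union> B = A" using assms by blast
  finally show ?thesis by simp
qed

lemma vector_measure_finite_UN:
  assumes \<nu>: "vector_measure \<nu>" and "finite I" "\<And>i. i \<in> I \<Longrightarrow> E i \<in> sets borel" "disjoint_family_on E I"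
  shows "\<nu> (\<Union>i\<in>I. E i) = (\<Sum>i\<in>I. \<nu> (E i))"
  using assms(2-)
proof (induction I rule: finite_induct)
  case empty
  then show ?case by (simp add: vector_measure_empty[OF \<nu>])
next
  case (insert i I)
  have "\<nu> (\<Union>j\<in>insert i I. E j) = \<nu> (E i) + \<nu> (\<Union>j\<in>I. E j)"
    using insert.prems insert.hyps
    by (subst vector_measure_Un[OF \<nu>, symmetric]) (auto simp: disjoint_family_on_def)
  with insert show ?case by (simp add: disjoint_family_on_def)
qed

text \<open>If arbitrarily large values occurred inside a Borel set, the set could be split off a piece
  of value at least one such that large values still occur in the remainder; iterating
  gives disjoint pieces whose values do not tend to zero.\<close>

lemma vector_measure_bounded:
  fixes \<nu> :: "'a::topological_space set \<Rightarrow> 'b::real_normed_vector"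
  assumes \<nu>: "vector_measure \<nu>"
  shows "\<exists>K. \<forall>B\<in>sets borel. norm (\<nu> B) \<le> K"
proof -
  define unb where "unb E \<longleftrightarrow> E \<in> sets borel \<and> (\<forall>K. \<exists>C\<in>sets borel. C \<subseteq> E \<and> norm (\<nu> C) > K)"
    for E :: "'a set"
  have split: "\<exists>F. unb F \<and> F \<subseteq> E \<and> norm (\<nu> (E - F)) \<ge> 1" if E: "unb E" for E
  proof -
    obtain C where C: "C \<in> sets borel" "C \<subseteq> E" "norm (\<nu> C) > norm (\<nu> E) + 1"
      using E unfolding unb_def by blast
    have Eb: "E \<in> sets borel" using E unfolding unb_def by blast
    have D: "\<nu> (E - C) = \<nu> E - \<nu> C"
      using vector_measure_Diff[OF \<nu>] C Eb by blast
    have D1: "norm (\<nu> (E - C)) \<ge> 1"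
      using C(3) norm_triangle_ineq2[of "\<nu> C" "\<nu> E"] unfolding D by (simp add: norm_minus_commute)
    have C1: "norm (\<nu> (E - (E - C))) \<ge> 1"
    proof -
      have "E - (E - C) = C" using C(2) by blast
      thus ?thesis using C(3) norm_ge_zero[of "\<nu> E"] by (simp only:)
    qed
    have "unb C \<or> unb (E - C)"
    proof (rule ccontr)
      assume "\<not> ?thesis"
      hence "\<exists>K. \<forall>B\<in>sets borel. B \<subseteq> C \<longrightarrow> norm (\<nu> B) \<le> K"
        "\<exists>K. \<forall>B\<in>sets borel. B \<subseteq> E - C \<longrightarrow> norm (\<nu> B) \<le> K"
        using C(1) Eb unfolding unb_def by (auto simp: not_less)
      then obtain K1 K2 where K: "\<forall>B\<in>sets borel. B \<subseteq> C \<longrightarrow> norm (\<nu> B) \<le> K1"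
        "\<forall>B\<in>sets borel. B \<subseteq> E - C \<longrightarrow> norm (\<nu> B) \<le> K2"
        by (elim exE)
      obtain B where B: "B \<in> sets borel" "B \<subseteq> E" "norm (\<nu> B) > K1 + K2"
        using E unfolding unb_def by blast
      have "\<nu> B = \<nu> (B \<inter> C) + \<nu> (B - C)"
        using vector_measure_Un[OF \<nu>, of "B \<inter> C" "B - C"] B C by (simp add: Int_Diff_Un Int_Diff_disjoint)
      moreover have "norm (\<nu> (B \<inter> C)) \<le> K1"
        using K(1) sets.Int[OF B(1) C(1)] by blast
      moreover have "norm (\<nu> (B - C)) \<le> K2"
        using K(2) sets.Diff[OF B(1) C(1)] Diff_mono[OF B(2) order_refl] by blast
      ultimately show False using B(3) norm_triangle_ineq[of "\<nu> (B \<inter> C)" "\<nu> (B - C)"] by simp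
    qed
    thus ?thesis using C1 D1 C(2) by blast
  qed
  show ?thesis
  proof (cases "unb UNIV")
    case False
    thus ?thesis unfolding unb_def by (auto simp: not_less)
  next
    case True
    define next_set where "next_set E = (SOME F. unb F \<and> F \<subseteq> E \<and> norm (\<nu> (E - F)) \<ge> 1)" for E
    have nxt: "unb (next_set E)" "next_set E \<subseteq> E" "norm (\<nu> (E - next_set E)) \<ge> 1" if "unb E" for E
      using someI_ex[OF split[OF that]] unfolding next_set_def by blast+
    define F where "F k = (next_set ^^ k) UNIV" for k
    have F: "unb (F k)" for k
      by (induction k) (simp_all add: F_def True nxt(1))
    have FS: "F (Suc k) = next_set (F k)" for k by (simp add: F_def)
    have dec: "decseq F"
      by (rule decseq_SucI) (simp add: FS nxt(2)[OF F])
    have meas: "F k \<in> sets borel" for k using F[of k] unfolding unb_def by blast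
    have "disjoint_family (\<lambda>k. F k - F (Suc k))"
      unfolding disjoint_family_on_def
    proof (intro ballI impI)
      fix i j :: nat assume "i \<noteq> j"
      have "(F i - F (Suc i)) \<inter> (F j - F (Suc j)) = {}" if "i < j" for i j
        using decseqD[OF dec, of "Suc i" j] that by auto
      thus "(F i - F (Suc i)) \<inter> (F j - F (Suc j)) = {}"
        using \<open>i \<noteq> j\<close> by (metis Int_commute linorder_neqE_nat)
    qed
    hence "(\<lambda>k. \<nu> (F k - F (Suc k))) sums \<nu> (\<Union>k. F k - F (Suc k))"
      using meas by (intro vector_measure_sums[OF \<nu>]) auto
    hence "(\<lambda>k. \<nu> (F k - F (Suc k))) \<longlonglongrightarrow> 0"
      by (rule sums_summable[THEN summable_LIMSEQ_zero])
    from LIMSEQ_D[OF this, of 1] obtain k where "norm (\<nu> (F k - F (Suc k)) - 0) < 1"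
      by auto
    hence "norm (\<nu> (F k - F (Suc k))) < 1" by simp
    thus ?thesis using nxt(3)[OF F[of k]] by (simp add: FS)
  qed
qed

lemma ennreal_norm_le_suminf:
  assumes "f sums s"
  shows "ennreal (norm s) \<le> (\<Sum>i. ennreal (norm (f i)))"
proof (rule LIMSEQ_le_const2)
  have "(\<lambda>n. \<Sum>i<n. f i) \<longlonglongrightarrow> s" using assms by (simp add: sums_def)
  thus "(\<lambda>n. ennreal (norm (\<Sum>i<n. f i))) \<longlonglongrightarrow> ennreal (norm s)"
    by (intro tendsto_ennrealI tendsto_norm)
  have "ennreal (norm (\<Sum>i<n. f i)) \<le> (\<Sum>i. ennreal (norm (f i)))" for n
  proof -
    have "ennreal (norm (\<Sum>i<n. f i)) \<le> (\<Sum>i<n. ennreal (norm (f i)))"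
      by (simp add: ennreal_leI norm_sum)
    also have "\<dots> \<le> (\<Sum>i. ennreal (norm (f i)))" by (rule sum_le_suminf) auto
    finally show ?thesis .
  qed
  thus "\<exists>N. \<forall>n\<ge>N. ennreal (norm (\<Sum>i<n. f i)) \<le> (\<Sum>i. ennreal (norm (f i)))" by blast
qed

text \<open>The set function inside \<^const>\<open>total_variation\<close>, with its index set of partitions and its
  summand separated, so that its countable additivity can be proved before it is known to be a
  measure.\<close>

definition variation_sum :: "('a set \<Rightarrow> 'b::real_normed_vector) \<Rightarrow> (nat \<Rightarrow> 'a set) \<Rightarrow> ennreal" where
  "variation_sum \<nu> E = (\<Sum>i. ennreal (norm (\<nu> (E i))))"

definition borel_partitions :: "'a::topological_space set \<Rightarrow> (nat \<Rightarrow> 'a set) set" where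
  "borel_partitions B = {E. range E \<subseteq> sets borel \<and> disjoint_family E \<and> (\<Union>i. E i) = B}"

definition variation :: "('a::topological_space set \<Rightarrow> 'b::real_normed_vector) \<Rightarrow> 'a set \<Rightarrow> ennreal" where
  "variation \<nu> B = (SUP E\<in>borel_partitions B. variation_sum \<nu> E)"

lemma borel_partitionsD:
  assumes "E \<in> borel_partitions B"
  shows "E i \<in> sets borel" "i \<noteq> j \<Longrightarrow> E i \<inter> E j = {}" "(\<Union>i. E i) = B" "E i \<subseteq> B"
    "disjoint_family E" "range E \<subseteq> sets borel"
proof -
  show "(\<Union>i. E i) = B" "disjoint_family E" "range E \<subseteq> sets borel"
    using assms by (simp_all add: borel_partitions_def)
  thus "E i \<subseteq> B" "E i \<in> sets borel" "i \<noteq> j \<Longrightarrow> E i \<inter> E j = {}"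
    by (auto simp: disjoint_family_on_def)
qed

lemma total_variation_alt: "total_variation \<nu> = measure_of UNIV (sets borel) (variation \<nu>)"
  unfolding total_variation_def variation_def[abs_def] borel_partitions_def variation_sum_def ..

lemma binaryset_partition:
  "A \<in> sets borel \<Longrightarrow> B \<in> sets borel \<Longrightarrow> A \<inter> B = {} \<Longrightarrow> binaryset A B \<in> borel_partitions (A \<union> B)"
  by (simp add: borel_partitions_def range_binaryset_eq UN_binaryset_eq disjoint_family_binaryset)

lemma borel_partitions_nonempty: "B \<in> sets borel \<Longrightarrow> borel_partitions B \<noteq> {}"
  using binaryset_partition[of B "{}"] by auto

lemma norm_le_variation:
  assumes \<nu>: "vector_measure \<nu>" and B: "B \<in> sets borel"
  shows "ennreal (norm (\<nu> B)) \<le> variation \<nu> B"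
proof -
  have p: "binaryset B {} \<in> borel_partitions B" using binaryset_partition[of B "{}"] B by simp
  hence "(\<lambda>i. \<nu> (binaryset B {} i)) sums \<nu> B"
    using vector_measure_sums[OF \<nu>, of "binaryset B {}"] by (simp add: borel_partitions_def)
  from ennreal_norm_le_suminf[OF this] p show ?thesis
    unfolding variation_def variation_sum_def by (rule SUP_upper2[rotated])
qed

text \<open>Interleaving a partition of \<open>A\<close> with one of \<open>B\<close> gives a partition of \<open>A \<union> B\<close>. Together with
  monotonicity this is the half of countable additivity that concerns the lower bound.\<close>

lemma variation_superadditive:
  assumes A: "A \<in> sets borel" and B: "B \<in> sets borel" and AB: "A \<inter> B = {}"
  shows "variation \<nu> A + variation \<nu> B \<le> variation \<nu> (A \<union> B)"
proof -
  have pair: "variation_sum \<nu> E + variation_sum \<nu> F \<le> variation \<nu> (A \<union> B)"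
    if E: "E \<in> borel_partitions A" and F: "F \<in> borel_partitions B" for E F
  proof -
    define g where "g n = (if even n then E (n div 2) else F (n div 2))" for n :: nat
    have EA: "E i \<subseteq> A" and FB: "F i \<subseteq> B" for i
      using borel_partitionsD(4)[OF E] borel_partitionsD(4)[OF F] by auto
    have "g \<in> borel_partitions (A \<union> B)"
    proof -
      have "range g \<subseteq> sets borel" using borel_partitionsD(1)[OF E] borel_partitionsD(1)[OF F] by (auto simp: g_def)
      moreover have "disjoint_family g"
        unfolding disjoint_family_on_def
      proof (intro ballI impI)
        fix m n :: nat assume mn: "m \<noteq> n"
        have dE: "E i \<inter> E j = {}" and dF: "F i \<inter> F j = {}" if "i \<noteq> j" for i j
          using borel_partitionsD(2)[OF E that] borel_partitionsD(2)[OF F that] by auto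
        have dEF: "E i \<inter> F j = {}" for i j using EA[of i] FB[of j] AB by blast
        have dFE: "F i \<inter> E j = {}" for i j using EA[of j] FB[of i] AB by blast
        consider "even m" "even n" | "odd m" "odd n" | "even m" "odd n" | "odd m" "even n" by blast
        thus "g m \<inter> g n = {}"
        proof cases
          case 1
          hence "m div 2 \<noteq> n div 2" using mn by (metis dvd_mult_div_cancel)
          thus ?thesis using 1 dE by (simp add: g_def)
        next
          case 2
          hence "m div 2 \<noteq> n div 2" using mn by (metis odd_two_times_div_two_succ)
          thus ?thesis using 2 dF by (simp add: g_def)
        qed (simp_all add: g_def dEF dFE)
      qed
      moreover have "(\<Union>i. g i) = A \<union> B"
      proof
        show "(\<Union>i. g i) \<subseteq> A \<union> B" using EA FB by (fastforce simp: g_def split: if_splits)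
        have "E i = g (2*i)" "F i = g (2*i+1)" for i by (auto simp: g_def)
        hence "E i \<subseteq> (\<Union>i. g i)" "F i \<subseteq> (\<Union>i. g i)" for i by blast+
        moreover have "A = (\<Union>i. E i)" "B = (\<Union>i. F i)" 
          using borel_partitionsD(3)[OF E] borel_partitionsD(3)[OF F] by auto
        ultimately show "A \<union> B \<subseteq> (\<Union>i. g i)" by blast
      qed
      ultimately show ?thesis by (simp add: borel_partitions_def)
    qed
    moreover have "variation_sum \<nu> E + variation_sum \<nu> F = variation_sum \<nu> g"
    proof -
      let ?a = "\<lambda>i. ennreal (norm (\<nu> (E i)))" and ?b = "\<lambda>i. ennreal (norm (\<nu> (F i)))"
      let ?c = "\<lambda>i. ennreal (norm (\<nu> (g i)))"
      have part: "(\<Sum>i<n. ?a i + ?b i) = (\<Sum>i<2*n. ?c i)" for n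
        by (induction n) (auto simp: g_def algebra_simps)
      have "(\<lambda>n. \<Sum>i<n. ?a i + ?b i) \<longlonglongrightarrow> (\<Sum>i. ?a i + ?b i)"
        by (rule summable_LIMSEQ) auto
      moreover have "(\<lambda>n. \<Sum>i<2*n. ?c i) \<longlonglongrightarrow> (\<Sum>i. ?c i)"
      proof -
        have "strict_mono (\<lambda>n::nat. 2*n)" by (simp add: strict_mono_def)
        from LIMSEQ_subseq_LIMSEQ[OF summable_LIMSEQ[of ?c, OF summableI] this]
        show ?thesis unfolding o_def .
      qed
      ultimately have "(\<Sum>i. ?a i + ?b i) = (\<Sum>i. ?c i)"
        unfolding part by (rule LIMSEQ_unique)
      thus ?thesis unfolding variation_sum_def by (subst suminf_add) auto
    qed
    ultimately show ?thesis unfolding variation_def by (simp add: SUP_upper)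
  qed
  have "variation \<nu> A + variation_sum \<nu> F \<le> variation \<nu> (A \<union> B)" if "F \<in> borel_partitions B" for F
    unfolding variation_def[of \<nu> A]
    by (subst ennreal_SUP_add_left[symmetric]) (auto intro!: SUP_least pair that borel_partitions_nonempty A)
  thus ?thesis unfolding variation_def[of \<nu> B]
    by (subst ennreal_SUP_add_right) (auto intro!: SUP_least borel_partitions_nonempty B)
qed

lemma variation_mono:
  assumes "A \<in> sets borel" "B \<in> sets borel" "A \<subseteq> B"
  shows "variation \<nu> A \<le> variation \<nu> B"
proof -
  have "variation \<nu> A \<le> variation \<nu> A + variation \<nu> (B - A)" by simp
  also have "\<dots> \<le> variation \<nu> (A \<union> (B - A))"
    using assms by (intro variation_superadditive) auto
  also have "A \<union> (B - A) = B" using assms by blast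
  finally show ?thesis .
qed

text \<open>For the upper bound, cut every piece of a partition of the union along the sets \<open>B k\<close> and
  exchange the two sums.\<close>

lemma variation_countably_additive:
  fixes \<nu> :: "'a::topological_space set \<Rightarrow> 'b::real_normed_vector"
  assumes \<nu>: "vector_measure \<nu>"
  shows "countably_additive (sets borel) (variation \<nu>)"
  unfolding countably_additive_def
proof (intro allI impI)
  fix B :: "nat \<Rightarrow> 'a set"
  assume B: "range B \<subseteq> sets borel" "disjoint_family B" "(\<Union>i. B i) \<in> sets borel"
  hence Bm: "B i \<in> sets borel" for i by blast
  have "(\<Sum>i. variation \<nu> (B i)) \<le> variation \<nu> (\<Union>i. B i)"
  proof (rule suminf_le_const)
    fix n
    have "(\<Sum>i<n. variation \<nu> (B i)) \<le> variation \<nu> (\<Union>i<n. B i)"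
    proof (induction n)
      case (Suc n)
      have "(\<Union>i<n. B i) \<inter> B n = {}"
      proof -
        have "B i \<inter> B n = {}" if "i < n" for i
          using that by (intro disjoint_family_onD[OF B(2)]) auto
        thus ?thesis by blast
      qed
      hence "variation \<nu> (\<Union>i<n. B i) + variation \<nu> (B n) \<le> variation \<nu> ((\<Union>i<n. B i) \<union> B n)"
        using Bm by (intro variation_superadditive) auto
      with add_right_mono[OF Suc.IH, of "variation \<nu> (B n)"]
      have "(\<Sum>i<n. variation \<nu> (B i)) + variation \<nu> (B n) \<le> variation \<nu> ((\<Union>i<n. B i) \<union> B n)"
        by (rule order_trans)
      thus ?case by (simp add: lessThan_Suc Un_commute add.commute)
    qed simp
    also have "\<dots> \<le> variation \<nu> (\<Union>i. B i)" using Bm by (intro variation_mono) auto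
    finally show "(\<Sum>i<n. variation \<nu> (B i)) \<le> variation \<nu> (\<Union>i. B i)" .
  qed simp
  moreover have "variation \<nu> (\<Union>i. B i) \<le> (\<Sum>i. variation \<nu> (B i))"
    unfolding variation_def[of _ "\<Union>i. B i"]
  proof (rule SUP_least)
    fix E assume E: "E \<in> borel_partitions (\<Union>i. B i)"
    hence Em: "E i \<in> sets borel" for i by (auto simp: borel_partitions_def)
    have dE: "disjoint_family E" using E by (simp add: borel_partitions_def)
    have "variation_sum \<nu> E \<le> (\<Sum>i. \<Sum>k. ennreal (norm (\<nu> (E i \<inter> B k))))"
      unfolding variation_sum_def
    proof (intro suminf_le)
      fix i
      have "E i \<subseteq> (\<Union>i. B i)" by (rule borel_partitionsD(4)[OF E])
      hence "(\<Union>k. E i \<inter> B k) = E i" by blast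
      moreover have "disjoint_family (\<lambda>k. E i \<inter> B k)" using B(2) by (auto simp: disjoint_family_on_def)
      moreover have "range (\<lambda>k. E i \<inter> B k) \<subseteq> sets borel"
        using sets.Int[OF Em Bm] by (simp add: image_subset_iff)
      ultimately have "(\<lambda>k. \<nu> (E i \<inter> B k)) sums \<nu> (E i)"
        using vector_measure_sums[OF \<nu>, of "\<lambda>k. E i \<inter> B k"] by simp
      thus "ennreal (norm (\<nu> (E i))) \<le> (\<Sum>k. ennreal (norm (\<nu> (E i \<inter> B k))))"
        by (rule ennreal_norm_le_suminf)
    qed auto
    also have "\<dots> = (\<Sum>k. \<Sum>i. ennreal (norm (\<nu> (E i \<inter> B k))))"
    proof -
      have "(\<integral>\<^sup>+i. (\<Sum>k. ennreal (norm (\<nu> (E i \<inter> B k)))) \<partial>count_space UNIV)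
          = (\<Sum>k. \<integral>\<^sup>+i. ennreal (norm (\<nu> (E i \<inter> B k))) \<partial>count_space UNIV)"
        by (rule nn_integral_suminf) simp
      thus ?thesis by (simp only: nn_integral_count_space_nat)
    qed
    also have "\<dots> \<le> (\<Sum>k. variation \<nu> (B k))"
    proof (intro suminf_le)
      fix k
      have "B k \<subseteq> (\<Union>i. E i)" unfolding borel_partitionsD(3)[OF E] by blast
      hence "(\<lambda>i. E i \<inter> B k) \<in> borel_partitions (B k)"
        using sets.Int[OF Em Bm] disjoint_family_on_bisimulation[OF dE, of "\<lambda>i. E i \<inter> B k"]
        by (auto simp: borel_partitions_def)
      thus "(\<Sum>i. ennreal (norm (\<nu> (E i \<inter> B k)))) \<le> variation \<nu> (B k)"
        unfolding variation_def variation_sum_def by (rule SUP_upper2) simp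
    qed auto
    finally show "variation_sum \<nu> E \<le> (\<Sum>k. variation \<nu> (B k))" .
  qed
  ultimately show "(\<Sum>i. variation \<nu> (B i)) = variation \<nu> (\<Union>i. B i)" by (rule antisym)
qed

lemma variation_empty:
  assumes \<nu>: "vector_measure \<nu>"
  shows "variation \<nu> {} = 0"
proof -
  have "variation_sum \<nu> E = 0" if "E \<in> borel_partitions {}" for E
    using that vector_measure_empty[OF \<nu>] by (simp add: borel_partitions_def variation_sum_def)
  hence "variation \<nu> {} \<le> 0" unfolding variation_def by (intro SUP_least) simp
  thus ?thesis by simp
qed

lemma space_total_variation [simp]: "space (total_variation \<nu>) = UNIV"
  by (simp add: total_variation_alt space_measure_of_conv)

lemma sets_total_variation [simp, measurable_cong]: "sets (total_variation \<nu>) = sets borel"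
  unfolding total_variation_alt
  using sets.sigma_sets_eq[of borel] by (simp add: sets_measure_of_conv)

lemma emeasure_total_variation:
  assumes \<nu>: "vector_measure \<nu>" and B: "B \<in> sets borel"
  shows "emeasure (total_variation \<nu>) B = variation \<nu> B"
  unfolding total_variation_alt
proof (rule emeasure_measure_of_sigma)
  show "sigma_algebra UNIV (sets borel)" using sets.sigma_algebra_axioms[of borel] by simp
  show "positive (sets borel) (variation \<nu>)" by (simp add: positive_def variation_empty[OF \<nu>])
qed (rule variation_countably_additive[OF \<nu>], rule B)

lemma norm_le_total_variation:
  assumes "vector_measure \<nu>" "B \<in> sets borel"
  shows "ennreal (norm (\<nu> B)) \<le> emeasure (total_variation \<nu>) B"
  using norm_le_variation[OF assms] emeasure_total_variation[OF assms] by simp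

text \<open>Minimality of the total variation is what turns setwise bounds of a vector measure into bounds
  of transport costs.\<close>

lemma total_variation_least:
  assumes \<nu>: "vector_measure \<nu>" and N: "sets N = sets borel"
    and le: "\<And>B. B \<in> sets borel \<Longrightarrow> ennreal (norm (\<nu> B)) \<le> emeasure N B"
    and B: "B \<in> sets borel"
  shows "emeasure (total_variation \<nu>) B \<le> emeasure N B"
  unfolding emeasure_total_variation[OF \<nu> B] variation_def
proof (rule SUP_least)
  fix E assume E: "E \<in> borel_partitions B"
  note E' = borel_partitionsD(3,5,6)[OF this]
  have "variation_sum \<nu> E \<le> (\<Sum>i. emeasure N (E i))"
    unfolding variation_sum_def using E' by (intro suminf_le le) auto
  also have "\<dots> = emeasure N B" using E' N by (subst suminf_emeasure) auto
  finally show "variation_sum \<nu> E \<le> emeasure N B" .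
qed

text \<open>Here the dimension enters. In each coordinate, the absolute values over a finite family of
  disjoint sets sum up to the value of the union of the nonnegative pieces minus that of the union
  of the negative ones, which is bounded.\<close>

lemma finite_measure_total_variation:
  fixes \<nu> :: "'a::topological_space set \<Rightarrow> 'b::euclidean_space"
  assumes \<nu>: "vector_measure \<nu>"
  shows "finite_measure (total_variation \<nu>)"
proof -
  obtain K where K: "\<And>B. B \<in> sets borel \<Longrightarrow> norm (\<nu> B) \<le> K" using vector_measure_bounded[OF \<nu>] by (elim exE) (rule that, erule bspec)
  have bound: "variation_sum \<nu> E \<le> ennreal (DIM('b) * (2 * K))" if E: "E \<in> borel_partitions UNIV" for E
    unfolding variation_sum_def
  proof (rule suminf_le_const)
    fix n
    have Em: "E i \<in> sets borel" for i by (rule borel_partitionsD(1)[OF E])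
    have dE: "disjoint_family_on E I" for I
      by (rule disjoint_family_on_mono[OF _ borel_partitionsD(5)[OF E]]) simp
    have comp: "(\<Sum>i<n. \<bar>\<nu> (E i) \<bullet> b\<bar>) \<le> 2 * K" if b: "b \<in> Basis" for b
    proof -
      define P where "P = {i. i < n \<and> \<nu> (E i) \<bullet> b \<ge> 0}"
      define Q where "Q = {i. i < n \<and> \<not> \<nu> (E i) \<bullet> b \<ge> 0}"
      have fin: "finite P" "finite Q" by (auto simp: P_def Q_def)
      have "(\<Sum>i<n. \<bar>\<nu> (E i) \<bullet> b\<bar>) = (\<Sum>i\<in>P \<union> Q. \<bar>\<nu> (E i) \<bullet> b\<bar>)"
        by (rule sum.cong) (auto simp: P_def Q_def)
      also have "\<dots> = (\<Sum>i\<in>P. \<bar>\<nu> (E i) \<bullet> b\<bar>) + (\<Sum>i\<in>Q. \<bar>\<nu> (E i) \<bullet> b\<bar>)"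
        using fin by (rule sum.union_disjoint) (auto simp: P_def Q_def)
      also have "\<dots> = (\<Sum>i\<in>P. \<nu> (E i) \<bullet> b) + (\<Sum>i\<in>Q. - (\<nu> (E i) \<bullet> b))"
        by (intro arg_cong2[where f="(+)"] sum.cong) (auto simp: P_def Q_def)
      also have "\<dots> = \<nu> (\<Union>i\<in>P. E i) \<bullet> b - \<nu> (\<Union>i\<in>Q. E i) \<bullet> b"
        using fin Em dE by (simp add: vector_measure_finite_UN[OF \<nu>] inner_sum_left sum_negf)
      also have "\<dots> \<le> norm (\<nu> (\<Union>i\<in>P. E i)) + norm (\<nu> (\<Union>i\<in>Q. E i))"
        using Basis_le_norm[OF b, of "\<nu> (\<Union>i\<in>P. E i)"] Basis_le_norm[OF b, of "\<nu> (\<Union>i\<in>Q. E i)"] by linarith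
      also have "\<dots> \<le> 2 * K"
        using K[of "\<Union>i\<in>P. E i"] K[of "\<Union>i\<in>Q. E i"] Em fin by auto
      finally show ?thesis .
    qed
    have "(\<Sum>i<n. norm (\<nu> (E i))) \<le> (\<Sum>i<n. \<Sum>b\<in>Basis. \<bar>\<nu> (E i) \<bullet> b\<bar>)"
      by (intro sum_mono norm_le_l1)
    also have "\<dots> = (\<Sum>b\<in>Basis. \<Sum>i<n. \<bar>\<nu> (E i) \<bullet> b\<bar>)" by (rule sum.swap)
    also have "\<dots> \<le> (\<Sum>b\<in>(Basis::'b set). 2 * K)" by (intro sum_mono comp)
    finally show "(\<Sum>i<n. ennreal (norm (\<nu> (E i)))) \<le> ennreal (DIM('b) * (2 * K))"
      by (simp add: ennreal_leI)
  qed simp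
  have "variation \<nu> UNIV \<le> ennreal (DIM('b) * (2 * K))"
    unfolding variation_def by (intro SUP_least bound)
  hence "emeasure (total_variation \<nu>) UNIV \<noteq> \<infinity>"
    by (auto simp: emeasure_total_variation[OF \<nu>] top_unique)
  thus ?thesis by (intro finite_measureI) simp
qed

section \<open>Densities of vector measures and integration\<close>

text \<open>Writing a vector measure as a density against a positive measure turns every integral below
  into an ordinary Bochner integral. The positive measure is left arbitrary, since a restriction
  of \<open>\<nu>\<close> is most conveniently described by an integrand against the total variation of \<open>\<nu>\<close> itself.\<close>

definition vector_density ::
    "('a::topological_space set \<Rightarrow> 'b::euclidean_space) \<Rightarrow> 'a measure \<Rightarrow> ('a \<Rightarrow> 'b) \<Rightarrow> bool" where
  "vector_density \<nu> M h \<longleftrightarrow> sets M = sets borel \<and> integrable M h \<and>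
     (\<forall>B\<in>sets borel. \<nu> B = (LINT x:B|M. h x))"

lemma vector_densityD:
  assumes "vector_density \<nu> M h"
  shows "sets M = sets borel" "integrable M h" "B \<in> sets borel \<Longrightarrow> \<nu> B = (LINT x:B|M. h x)"
    "space M = UNIV" "h \<in> borel_measurable M"
proof -
  show M: "sets M = sets borel" "integrable M h" "B \<in> sets borel \<Longrightarrow> \<nu> B = (LINT x:B|M. h x)"
    using assms unfolding vector_density_def by blast+
  show "space M = UNIV" using sets_eq_imp_space_eq[OF M(1)] by simp
  show "h \<in> borel_measurable M" by (rule borel_measurable_integrable[OF M(2)])
qed

text \<open>A coordinate of \<open>\<nu>\<close> is dominated by the total variation, so adding the total variation makes it
  a positive measure, to which the Radon--Nikodym theorem applies.\<close>

lemma total_variation_density_component: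
  fixes \<nu> :: "'a::topological_space set \<Rightarrow> 'b::euclidean_space"
  assumes \<nu>: "vector_measure \<nu>" and b: "b \<in> Basis"
  shows "\<exists>f. vector_density (\<lambda>B. \<nu> B \<bullet> b) (total_variation \<nu>) f"
proof -
  let ?M = "total_variation \<nu>"
  interpret M: finite_measure ?M by (rule finite_measure_total_variation[OF \<nu>])
  have le: "norm (\<nu> B) \<le> measure ?M B" if "B \<in> sets borel" for B
    using norm_le_total_variation[OF \<nu> that] by (simp add: M.emeasure_eq_measure)
  define \<kappa> where "\<kappa> B = \<nu> B \<bullet> b + measure ?M B" for B
  have nonneg: "0 \<le> \<kappa> B" if "B \<in> sets borel" for B
    using Basis_le_norm[OF b, of "\<nu> B"] le[OF that] unfolding \<kappa>_def by linarith
  define N where "N = measure_of UNIV (sets borel) (\<lambda>B. ennreal (\<kappa> B))"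
  have sets_N: "sets N = sets borel"
    unfolding N_def using sets.sigma_sets_eq[of borel] by (simp add: sets_measure_of_conv)
  have space_N: "space N = UNIV" by (simp add: N_def space_measure_of_conv)
  have emeasure_N: "emeasure N B = ennreal (\<kappa> B)" if B: "B \<in> sets borel" for B
    unfolding N_def
  proof (rule emeasure_measure_of_sigma[OF _ _ _ B])
    show "sigma_algebra UNIV (sets borel)" using sets.sigma_algebra_axioms[of borel] by simp
    show "positive (sets borel) (\<lambda>B. ennreal (\<kappa> B))"
      by (simp add: positive_def \<kappa>_def vector_measure_empty[OF \<nu>])
    show "countably_additive (sets borel) (\<lambda>B. ennreal (\<kappa> B))"
      unfolding countably_additive_def
    proof (intro allI impI)
      fix E :: "nat \<Rightarrow> 'a set"
      assume E: "range E \<subseteq> sets borel" "disjoint_family E" "(\<Union>i. E i) \<in> sets borel"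
      have "(\<lambda>i. \<nu> (E i) \<bullet> b) sums (\<nu> (\<Union>i. E i) \<bullet> b)"
        by (rule bounded_linear.sums[OF bounded_linear_inner_left vector_measure_sums[OF \<nu> E(1,2)]])
      moreover have "(\<lambda>i. measure ?M (E i)) sums measure ?M (\<Union>i. E i)"
        using E by (intro M.finite_measure_UNION) auto
      ultimately have "(\<lambda>i. \<kappa> (E i)) sums \<kappa> (\<Union>i. E i)"
        unfolding \<kappa>_def by (rule sums_add)
      moreover have "0 \<le> \<kappa> (E i)" for i using E(1) by (intro nonneg) blast
      ultimately show "(\<Sum>i. ennreal (\<kappa> (E i))) = ennreal (\<kappa> (\<Union>i. E i))"
        by (intro suminf_ennreal_eq)
    qed
  qed
  have ac: "absolutely_continuous ?M N"
  proof (unfold absolutely_continuous_def, rule subsetI)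
    fix B assume B: "B \<in> null_sets ?M"
    hence "B \<in> sets borel" "measure ?M B = 0" by (auto simp: measure_def null_setsD1 null_setsD2)
    moreover from this have "\<nu> B = 0" using le[of B] by simp
    ultimately show "B \<in> null_sets N"
      by (intro null_setsI) (simp_all add: emeasure_N sets_N \<kappa>_def)
  qed
  interpret N: finite_measure N
    by (rule finite_measureI) (simp add: space_N emeasure_N)
  have "AE x in ?M. RN_deriv ?M N x \<noteq> \<infinity>"
    using ac sets_N by (intro M.RN_deriv_finite N.sigma_finite_measure_axioms) auto
  define D where "D x = enn2real (RN_deriv ?M N x)" for x
  have D: "D \<in> borel_measurable ?M" "\<And>x. 0 \<le> D x"
    unfolding D_def by auto
  have RN_D: "AE x in ?M. ennreal (D x) = RN_deriv ?M N x"
    using \<open>AE x in ?M. RN_deriv ?M N x \<noteq> \<infinity>\<close>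
    by eventually_elim (simp add: D_def less_top)
  have "density ?M (\<lambda>x. ennreal (D x)) = density ?M (RN_deriv ?M N)"
    using D(1) RN_D by (intro density_cong) auto
  also have "\<dots> = N" using ac sets_N by (intro M.density_RN_deriv) auto
  finally have dN: "density ?M (\<lambda>x. ennreal (D x)) = N" .
  have int: "(\<integral>\<^sup>+x. ennreal (indicator B x * D x) \<partial>?M) = ennreal (\<kappa> B)" if B: "B \<in> sets borel" for B
  proof -
    have "(\<integral>\<^sup>+x. ennreal (indicator B x * D x) \<partial>?M) = (\<integral>\<^sup>+x. ennreal (D x) * indicator B x \<partial>?M)"
      by (intro nn_integral_cong) (simp add: indicator_def)
    also have "\<dots> = emeasure N B"
      unfolding dN[symmetric] using D(1) B by (intro emeasure_density[symmetric]) auto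
    finally show ?thesis using emeasure_N[OF B] by simp
  qed
  have intD: "integrable ?M D"
  proof (rule integrableI_nonneg)
    show "(\<integral>\<^sup>+x. ennreal (D x) \<partial>?M) < \<infinity>"
      using int[of UNIV] by simp
  qed (use D in auto)
  have "vector_density (\<lambda>B. \<nu> B \<bullet> b) ?M (\<lambda>x. D x - 1)"
    unfolding vector_density_def
  proof (intro conjI ballI)
    show "integrable ?M (\<lambda>x. D x - 1)" using intD by simp
    fix B :: "'a set" assume B: "B \<in> sets borel"
    have iB: "integrable ?M (\<lambda>x. indicator B x * D x)"
      using integrable_mult_indicator[OF _ intD, of B] B by simp
    have "(LINT x:B|?M. D x - 1) = (\<integral>x. indicator B x * D x \<partial>?M) - (\<integral>x. indicator B x \<partial>?M)"
      unfolding set_lebesgue_integral_def using iB B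
      by (subst Bochner_Integration.integral_diff[symmetric])
         (auto simp: algebra_simps M.emeasure_eq_measure intro!: integrable_real_indicator)
    also have "(\<integral>x. indicator B x * D x \<partial>?M) = \<kappa> B"
      using int[OF B] nonneg[OF B] D(2) nn_integral_eq_integral[OF iB]
      by (simp add: integral_nonneg_AE)
    finally show "\<nu> B \<bullet> b = (LINT x:B|?M. D x - 1)" using B by (simp add: \<kappa>_def)
  qed simp
  thus ?thesis by blast
qed

text \<open>One half of the polar decomposition. The averages of the density over sets of positive measure lie
  in the unit ball, hence so do almost all of its values.\<close>

lemma total_variation_density:
  fixes \<nu> :: "'a::topological_space set \<Rightarrow> 'b::euclidean_space"
  assumes \<nu>: "vector_measure \<nu>"
  shows "\<exists>h\<in>borel_measurable borel. (\<forall>x. norm (h x) \<le> 1) \<and> vector_density \<nu> (total_variation \<nu>) h"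
proof -
  let ?M = "total_variation \<nu>"
  interpret M: finite_measure ?M by (rule finite_measure_total_variation[OF \<nu>])
  have "\<forall>b\<in>Basis. \<exists>f. vector_density (\<lambda>B. \<nu> B \<bullet> b) ?M f"
    using total_variation_density_component[OF \<nu>] by blast
  then obtain f where f: "\<And>b. b \<in> Basis \<Longrightarrow> vector_density (\<lambda>B. \<nu> B \<bullet> b) ?M (f b)" by metis
  define h where "h x = (\<Sum>b\<in>Basis. f b x *\<^sub>R b)" for x
  have intf: "integrable ?M (f b)" if "b \<in> Basis" for b using f[OF that] by (simp add: vector_density_def)
  hence inth: "integrable ?M h" unfolding h_def by auto
  have h: "\<nu> B = (LINT x:B|?M. h x)" if B: "B \<in> sets borel" for B
  proof -
    have "(LINT x:B|?M. h x) = (\<integral>x. (\<Sum>b\<in>Basis. (indicator B x * f b x) *\<^sub>R b) \<partial>?M)"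
      unfolding set_lebesgue_integral_def h_def by (simp add: scaleR_sum_right)
    also have "\<dots> = (\<Sum>b\<in>Basis. (LINT x:B|?M. f b x) *\<^sub>R b)"
      unfolding set_lebesgue_integral_def
      using B integrable_mult_indicator[OF _ intf, of B]
      by (subst Bochner_Integration.integral_sum) auto
    also have "\<dots> = (\<Sum>b\<in>Basis. (\<nu> B \<bullet> b) *\<^sub>R b)"
      using f B by (intro sum.cong) (auto simp: vector_density_def)
    finally show ?thesis by (simp add: euclidean_representation)
  qed
  have le1: "AE x in ?M. h x \<in> cball 0 1"
  proof (rule M.averaging_theorem[OF inth])
    fix A assume A: "A \<in> sets ?M" "measure ?M A > 0"
    have "norm (\<nu> A) \<le> measure ?M A"
      using norm_le_total_variation[OF \<nu>, of A] A by (simp add: M.emeasure_eq_measure)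
    thus "(1 / measure ?M A) *\<^sub>R set_lebesgue_integral ?M A h \<in> cball 0 1"
      using A h[of A] by simp
  qed simp
  \<comment> \<open>a representative bounded everywhere spares null sets later\<close>
  define h' where "h' x = (if norm (h x) \<le> 1 then h x else 0)" for x
  have hm [measurable]: "h \<in> borel_measurable ?M" using inth by simp
  have h'm [measurable]: "h' \<in> borel_measurable ?M" unfolding h'_def by measurable
  have ae: "AE x in ?M. h' x = h x" using le1 by eventually_elim (simp add: h'_def)
  have "integrable ?M h'" using inth integrable_cong_AE[OF h'm hm ae] by simp
  moreover have "(LINT x:B|?M. h' x) = (LINT x:B|?M. h x)" if B: "B \<in> sets borel" for B
    unfolding set_lebesgue_integral_def
  proof (rule integral_cong_AE)
    show "AE x in ?M. indicat_real B x *\<^sub>R h' x = indicat_real B x *\<^sub>R h x" using ae by eventually_elim simp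
  qed (use B in measurable)
  ultimately have "vector_density \<nu> ?M h'" using h by (simp add: vector_density_def)
  moreover have "h' \<in> borel_measurable borel"
    using h'm measurable_cong_sets[OF sets_total_variation[of \<nu>] refl] by blast
  moreover have "\<forall>x. norm (h' x) \<le> 1" by (simp add: h'_def)
  ultimately show ?thesis by blast
qed

text \<open>The supremum defining the positive part is attained at the subset where the density is
  nonnegative.\<close>

lemma positive_part_density:
  assumes M: "vector_density \<nu> M h"
  shows "positive_part \<nu> = density M (\<lambda>x. ennreal (h x))"
proof -
  note sM = vector_densityD(1)[OF M] and int = vector_densityD(2)[OF M] and \<nu> = vector_densityD(3)[OF M]
    and sp = vector_densityD(4)[OF M]
  have [measurable]: "h \<in> borel_measurable M" using int by simp
  have iC: "integrable M (\<lambda>x. indicator C x * f x)" if "C \<in> sets borel" "integrable M f" for C and f :: "'a \<Rightarrow> real"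
    using integrable_mult_indicator[OF _ that(2), of C] that(1) sM by simp
  have eq: "(SUP C\<in>{C \<in> sets borel. C \<subseteq> B}. ennreal (\<nu> C)) = emeasure (density M (\<lambda>x. ennreal (h x))) B"
    if B: "B \<in> sets borel" for B
  proof -
    have imax: "integrable M (\<lambda>x. indicator B x * max 0 (h x))"
      using B int by (intro iC) auto
    have "emeasure (density M (\<lambda>x. ennreal (h x))) B = (\<integral>\<^sup>+x. ennreal (indicator B x * max 0 (h x)) \<partial>M)"
      using B sM by (subst emeasure_density)
        (auto intro!: nn_integral_cong simp: indicator_def max_def ennreal_neg)
    also have "\<dots> = ennreal (\<integral>x. indicator B x * max 0 (h x) \<partial>M)"
      using imax by (rule nn_integral_eq_integral) simp
    finally have dens: "emeasure (density M (\<lambda>x. ennreal (h x))) B = \<dots>" .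
    show ?thesis unfolding dens
    proof (rule antisym)
      show "(SUP C\<in>{C \<in> sets borel. C \<subseteq> B}. ennreal (\<nu> C)) \<le> ennreal (\<integral>x. indicator B x * max 0 (h x) \<partial>M)"
      proof (intro SUP_least ennreal_leI)
        fix C assume C: "C \<in> {C \<in> sets borel. C \<subseteq> B}"
        have "\<nu> C = (\<integral>x. indicator C x * h x \<partial>M)"
          using C \<nu> by (simp add: set_lebesgue_integral_def)
        also have "\<dots> \<le> (\<integral>x. indicator B x * max 0 (h x) \<partial>M)"
          using C imax iC[OF _ int, of C] by (intro integral_mono) (auto simp: indicator_def)
        finally show "\<nu> C \<le> (\<integral>x. indicator B x * max 0 (h x) \<partial>M)" .
      qed
      define C where "C = B \<inter> {x \<in> space M. 0 \<le> h x}"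
      have "C \<in> sets M" unfolding C_def using B sM by (intro sets.Int) (auto, measurable)
      hence C: "C \<in> sets borel" using sM by simp
      have "\<nu> C = (\<integral>x. indicator B x * max 0 (h x) \<partial>M)"
        unfolding \<nu>[OF C] set_lebesgue_integral_def
        by (intro Bochner_Integration.integral_cong) (auto simp: C_def indicator_def)
      moreover have "C \<subseteq> B" by (simp add: C_def)
      ultimately show "ennreal (\<integral>x. indicator B x * max 0 (h x) \<partial>M) \<le> (SUP C\<in>{C \<in> sets borel. C \<subseteq> B}. ennreal (\<nu> C))"
        using C by (intro SUP_upper2[of C]) auto
    qed
  qed
  have "positive_part \<nu> = measure_of UNIV (sets borel) (emeasure (density M (\<lambda>x. ennreal (h x))))"
    unfolding positive_part_def
    by (rule measure_of_eq) (use sets.sigma_sets_eq[of borel] eq in auto)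
  also have "\<dots> = density M (\<lambda>x. ennreal (h x))"
    using measure_of_of_measure[of "density M (\<lambda>x. ennreal (h x))"] sp sM by simp
  finally show ?thesis .
qed

lemma signed_integral_density:
  assumes M: "vector_density \<nu> M h" and f: "f \<in> borel_measurable M" and int: "integrable M (\<lambda>x. f x * h x)"
  shows "signed_integral \<nu> f = (\<integral>x. f x * h x \<partial>M)"
proof -
  have inth: "integrable M h" using M by (simp add: vector_density_def)
  hence [measurable]: "h \<in> borel_measurable M" by simp
  note [measurable] = f
  have M': "vector_density (\<lambda>B. - \<nu> B) M (\<lambda>x. - h x)"
    using M by (simp add: vector_density_def set_lebesgue_integral_def)
  have part: "integral\<^sup>L (density M (\<lambda>x. ennreal (g x))) f = (\<integral>x. max 0 (g x) * f x \<partial>M)"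
    if [measurable]: "g \<in> borel_measurable M" for g
  proof -
    have "density M (\<lambda>x. ennreal (g x)) = density M (\<lambda>x. ennreal (max 0 (g x)))"
      by (intro density_cong) (auto simp: max_def ennreal_neg)
    thus ?thesis by (simp add: integral_density f)
  qed
  have i1: "integrable M (\<lambda>x. max 0 (h x) * f x)"
    by (rule Bochner_Integration.integrable_bound[OF int]) (auto simp: abs_mult mult.commute[of "\<bar>f _\<bar>"] intro!: mult_right_mono)
  have i2: "integrable M (\<lambda>x. max 0 (- h x) * f x)"
    by (rule Bochner_Integration.integrable_bound[OF int]) (auto simp: abs_mult mult.commute[of "\<bar>f _\<bar>"] intro!: mult_right_mono)
  have "signed_integral \<nu> f = (\<integral>x. max 0 (h x) * f x \<partial>M) - (\<integral>x. max 0 (- h x) * f x \<partial>M)"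
    unfolding signed_integral_def positive_part_density[OF M] positive_part_density[OF M']
    by (simp add: part)
  also have "\<dots> = (\<integral>x. max 0 (h x) * f x - max 0 (- h x) * f x \<partial>M)"
    using i1 i2 by simp
  also have "\<dots> = (\<integral>x. f x * h x \<partial>M)"
    by (intro Bochner_Integration.integral_cong) (auto simp: max_def)
  finally show ?thesis .
qed

lemma vector_integral_density:
  fixes \<nu> :: "'a::topological_space set \<Rightarrow> real ^ 'm"
  assumes M: "vector_density \<nu> M h" and v: "v \<in> borel_measurable borel"
    and int: "integrable M (\<lambda>x. norm (v x) * norm (h x))"
  shows "vector_integral \<nu> v = (\<integral>x. v x \<bullet> h x \<partial>M)"
proof -
  note sM = vector_densityD(1)[OF M] and inth = vector_densityD(2)[OF M] and \<nu> = vector_densityD(3)[OF M]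
  have hm [measurable]: "h \<in> borel_measurable M" using inth by simp
  have vm [measurable]: "v \<in> borel_measurable M"
    using v measurable_cong_sets[OF sM refl] by blast
  have comp: "(\<lambda>y :: real ^ 'm. y $ i) \<in> borel_measurable borel" for i
    by (intro borel_measurable_continuous_onI continuous_intros)
  have [measurable]: "(\<lambda>x. v x $ i) \<in> borel_measurable M" "(\<lambda>x. h x $ i) \<in> borel_measurable M" for i
    using measurable_compose[OF vm comp] measurable_compose[OF hm comp] by auto
  have M': "vector_density (\<lambda>B. \<nu> B $ i) M (\<lambda>x. h x $ i)" for i
    unfolding vector_density_def
  proof (intro conjI ballI)
    have "integrable M (\<lambda>x. h x \<bullet> axis i 1)" using inth by simp
    thus "integrable M (\<lambda>x. h x $ i)" by (simp add: inner_axis)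
    fix B :: "'a set" assume B: "B \<in> sets borel"
    have iB: "integrable M (\<lambda>x. indicat_real B x *\<^sub>R h x)"
      using B sM inth by (intro integrable_mult_indicator) auto
    have "\<nu> B \<bullet> axis i 1 = (\<integral>x. (indicator B x *\<^sub>R h x) \<bullet> axis i 1 \<partial>M)"
      unfolding \<nu>[OF B] set_lebesgue_integral_def
      by (rule integral_inner_left[symmetric]) (rule iB)
    thus "\<nu> B $ i = (LINT x:B|M. h x $ i)"
      by (simp add: inner_axis set_lebesgue_integral_def)
  qed (rule sM)
  have ii: "integrable M (\<lambda>x. v x $ i * h x $ i)" for i
  proof (rule Bochner_Integration.integrable_bound[OF int])
    show "AE x in M. norm (v x $ i * h x $ i) \<le> norm (norm (v x) * norm (h x))"
      by (auto simp: abs_mult intro!: mult_mono component_le_norm_cart)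
  qed measurable
  have "vector_integral \<nu> v = (\<Sum>i\<in>UNIV. \<integral>x. v x $ i * h x $ i \<partial>M)"
    unfolding vector_integral_def
    by (intro sum.cong refl signed_integral_density[OF M']) (use ii in auto)
  also have "\<dots> = (\<integral>x. v x \<bullet> h x \<partial>M)"
    using ii by (simp add: inner_vec_def)
  finally show ?thesis .
qed

text \<open>For finitely many values the integral only sees the measures of the level sets. This is the link
  between Bochner integrals and conditions stated for set functions, such as those on marginals.\<close>

lemma integral_finite_range:
  fixes h :: "'a \<Rightarrow> 'b::euclidean_space"
  assumes fin: "finite (range T)" and meas: "\<And>z. T -` {z} \<in> sets M" and int: "integrable M h"
  shows "(\<integral>x. F (T x) \<bullet> h x \<partial>M) = (\<Sum>z\<in>range T. F z \<bullet> (LINT x:T -` {z}|M. h x))"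
proof -
  have i: "integrable M (\<lambda>x. indicat_real (T -` {z}) x *\<^sub>R h x)" for z
    by (rule integrable_mult_indicator[OF meas int])
  have "F (T x) \<bullet> h x = (\<Sum>z\<in>range T. F z \<bullet> (indicat_real (T -` {z}) x *\<^sub>R h x))" for x
  proof -
    have "(\<Sum>z\<in>range T. F z \<bullet> (indicat_real (T -` {z}) x *\<^sub>R h x)) = (\<Sum>z\<in>range T. if T x = z then F z \<bullet> h x else 0)"
      by (intro sum.cong) auto
    also have "\<dots> = F (T x) \<bullet> h x" using fin by simp
    finally show ?thesis by simp
  qed
  hence "(\<integral>x. F (T x) \<bullet> h x \<partial>M) = (\<integral>x. (\<Sum>z\<in>range T. F z \<bullet> (indicat_real (T -` {z}) x *\<^sub>R h x)) \<partial>M)"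
    by simp
  also have "\<dots> = (\<Sum>z\<in>range T. \<integral>x. F z \<bullet> (indicat_real (T -` {z}) x *\<^sub>R h x) \<partial>M)"
    by (intro Bochner_Integration.integral_sum integrable_inner_right i)
  also have "\<dots> = (\<Sum>z\<in>range T. F z \<bullet> (LINT x:T -` {z}|M. h x))"
    unfolding set_lebesgue_integral_def using i by (intro sum.cong refl integral_inner_right)
  finally show ?thesis .
qed

section \<open>Weak duality\<close>

lemma tendsto_integral_inner:
  fixes h :: "'a \<Rightarrow> 'b::euclidean_space"
  assumes h: "integrable M (\<lambda>x. w x * norm (h x))" "h \<in> borel_measurable M"
    and f: "\<And>j. f j \<in> borel_measurable M" "g \<in> borel_measurable M"
    and bound: "\<And>j x. norm (f j x) \<le> w x"
    and lim: "\<And>x. x \<in> space M \<Longrightarrow> (\<lambda>j. f j x) \<longlonglongrightarrow> g x"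
  shows "(\<lambda>j. \<integral>x. f j x \<bullet> h x \<partial>M) \<longlonglongrightarrow> (\<integral>x. g x \<bullet> h x \<partial>M)"
proof (rule integral_dominated_convergence[where w="\<lambda>x. w x * norm (h x)"])
  note [measurable] = h(2) f
  show "(\<lambda>x. g x \<bullet> h x) \<in> borel_measurable M" by measurable
  show "(\<lambda>x. f j x \<bullet> h x) \<in> borel_measurable M" for j by measurable
  show "AE x in M. (\<lambda>j. f j x \<bullet> h x) \<longlonglongrightarrow> g x \<bullet> h x"
    by (intro AE_I2 tendsto_inner lim tendsto_const)
  show "AE x in M. norm (f j x \<bullet> h x) \<le> w x * norm (h x)" for j
  proof (rule AE_I2)
    fix x
    have "norm (f j x \<bullet> h x) \<le> norm (f j x) * norm (h x)" by (simp add: Cauchy_Schwarz_ineq2)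
    also have "\<dots> \<le> w x * norm (h x)" by (intro mult_right_mono bound) simp
    finally show "norm (f j x \<bullet> h x) \<le> w x * norm (h x)" .
  qed
qed (rule h(1))

lemma measurable_fst_snd_borel:
  fixes P :: "('a::euclidean_space \<times> 'a) measure"
  assumes "sets P = sets borel"
  shows "fst \<in> measurable P borel" "snd \<in> measurable P borel"
proof -
  have "(fst :: 'a \<times> 'a \<Rightarrow> 'a) \<in> borel_measurable borel" "(snd :: 'a \<times> 'a \<Rightarrow> 'a) \<in> borel_measurable borel"
    by (intro borel_measurable_continuous_onI continuous_intros)+
  thus "fst \<in> measurable P borel" "snd \<in> measurable P borel"
    using measurable_cong_sets[OF assms refl] by blast+
qed

text \<open>The marginal condition says that the two integrals agree for indicators, hence for maps with
  finitely many values; bounded maps are limits of those.\<close>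

lemma pairing_bounded:
  fixes v :: "'a::euclidean_space \<Rightarrow> 'b::euclidean_space"
  assumes M: "vector_density \<nu> M h" and P: "vector_density \<pi> P k"
    and marg: "\<forall>B\<in>sets borel. marginal1 \<pi> B - marginal2 \<pi> B = \<nu> B"
    and v: "v \<in> borel_measurable borel" and bound: "\<And>x. norm (v x) \<le> K"
  shows "(\<integral>x. v x \<bullet> h x \<partial>M) = (\<integral>z. (v (fst z) - v (snd z)) \<bullet> k z \<partial>P)"
proof -
  note M' = vector_densityD[OF M] and P' = vector_densityD[OF P]
  note fs = measurable_fst_snd_borel[OF P'(1)]
  obtain s where s: "\<And>i. simple_function borel (s i)" "\<And>x. (\<lambda>i. s i x) \<longlonglongrightarrow> v x"
      "\<And>i x. dist (s i x) 0 \<le> 2 * dist (v x) 0"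
    using borel_measurable_implies_sequence_metric[OF v, of 0] unfolding space_borel by blast
  have sb: "norm (s i x) \<le> 2 * K" for i x using s(3)[of i x] bound[of x] by simp
  have sm: "s i \<in> borel_measurable borel" for i by (rule borel_measurable_simple_function[OF s(1)])
  have sM: "s i \<in> borel_measurable M" and vM: "v \<in> borel_measurable M" for i
    using sm v measurable_cong_sets[OF M'(1) refl] by blast+
  have fin: "finite (range (s i))" and vim: "s i -` {z} \<in> sets borel" for i z
    using simple_functionD[OF s(1)[of i]] by auto
  have eq: "(\<integral>x. s i x \<bullet> h x \<partial>M) = (\<integral>z. (s i (fst z) - s i (snd z)) \<bullet> k z \<partial>P)" for i
  proof -
    have r: "range (\<lambda>z::'a \<times> 'a. s i (fst z)) = range (s i)" "range (\<lambda>z::'a \<times> 'a. s i (snd z)) = range (s i)"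
      by (auto simp: image_iff)
    have vi: "(\<lambda>z::'a \<times> 'a. s i (fst z)) -` {c} = (s i -` {c}) \<times> UNIV" 
      "(\<lambda>z::'a \<times> 'a. s i (snd z)) -` {c} = UNIV \<times> (s i -` {c})" for c by auto
    have b: "(s i -` {c}) \<times> (UNIV :: 'a set) \<in> sets borel" "(UNIV :: 'a set) \<times> (s i -` {c}) \<in> sets borel" for c
      using vim by (auto intro!: borel_Times)
    have int: "integrable P (\<lambda>z. s i (g z) \<bullet> k z)" if g: "g \<in> measurable P borel" for g
    proof (rule Bochner_Integration.integrable_bound[where f="\<lambda>z. 2 * K * norm (k z)"])
      show "integrable P (\<lambda>z. 2 * K * norm (k z))" using P'(2) by simp
      show "(\<lambda>z. s i (g z) \<bullet> k z) \<in> borel_measurable P"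
        using measurable_compose[OF g sm] P'(5) by (rule borel_measurable_inner)
      show "AE z in P. norm (s i (g z) \<bullet> k z) \<le> norm (2 * K * norm (k z))"
      proof (rule AE_I2)
        fix z
        have "norm (s i (g z) \<bullet> k z) \<le> norm (s i (g z)) * norm (k z)" by (simp add: Cauchy_Schwarz_ineq2)
        also have "\<dots> \<le> 2 * K * norm (k z)" by (intro mult_right_mono sb) simp
        finally show "norm (s i (g z) \<bullet> k z) \<le> norm (2 * K * norm (k z))" by simp
      qed
    qed
    have "(\<integral>z. s i (fst z) \<bullet> k z \<partial>P) = (\<Sum>c\<in>range (s i). c \<bullet> marginal1 \<pi> (s i -` {c}))"
      using integral_finite_range[of "\<lambda>z. s i (fst z)" P k "\<lambda>c. c"] fin b P'
      by (simp add: r vi marginal1_def)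
    moreover have "(\<integral>z. s i (snd z) \<bullet> k z \<partial>P) = (\<Sum>c\<in>range (s i). c \<bullet> marginal2 \<pi> (s i -` {c}))"
      using integral_finite_range[of "\<lambda>z. s i (snd z)" P k "\<lambda>c. c"] fin b P'
      by (simp add: r vi marginal2_def)
    moreover have "(\<integral>x. s i x \<bullet> h x \<partial>M) = (\<Sum>c\<in>range (s i). c \<bullet> \<nu> (s i -` {c}))"
      using integral_finite_range[of "s i" M h "\<lambda>c. c"] fin vim M' by simp
    moreover have "\<nu> (s i -` {c}) = marginal1 \<pi> (s i -` {c}) - marginal2 \<pi> (s i -` {c})" for c
      using marg vim by metis
    ultimately show ?thesis
      using int[OF fs(1)] int[OF fs(2)]
      by (simp add: inner_diff_left inner_diff_right sum_subtractf)
  qed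
  have "(\<lambda>i. \<integral>x. s i x \<bullet> h x \<partial>M) \<longlonglongrightarrow> (\<integral>x. v x \<bullet> h x \<partial>M)"
    using M'(2) by (intro tendsto_integral_inner[where w="\<lambda>_. 2 * K"] sM vM s(2) sb M'(5)) simp
  moreover have "(\<lambda>i. \<integral>z. (s i (fst z) - s i (snd z)) \<bullet> k z \<partial>P) \<longlonglongrightarrow> (\<integral>z. (v (fst z) - v (snd z)) \<bullet> k z \<partial>P)"
  proof (rule tendsto_integral_inner[where w="\<lambda>_. 4 * K"])
    show "integrable P (\<lambda>x. 4 * K * norm (k x))" using P'(2) by simp
    show "(\<lambda>z. s i (fst z) - s i (snd z)) \<in> borel_measurable P" for i
      by (intro borel_measurable_diff measurable_compose[OF _ sm] fs)
    show "(\<lambda>z. v (fst z) - v (snd z)) \<in> borel_measurable P"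
      by (intro borel_measurable_diff measurable_compose[OF _ v] fs)
    show "norm (s i (fst z) - s i (snd z)) \<le> 4 * K" for i z
      using norm_triangle_ineq4[of "s i (fst z)" "s i (snd z)"] sb[of i "fst z"] sb[of i "snd z"] by linarith
    show "(\<lambda>i. s i (fst z) - s i (snd z)) \<longlonglongrightarrow> v (fst z) - v (snd z)" for z
      by (intro tendsto_diff s(2))
  qed (rule P'(5))
  ultimately show ?thesis unfolding eq by (rule LIMSEQ_unique)
qed

lemma lipschitz_borel_measurable:
  fixes v :: "'a::euclidean_space \<Rightarrow> 'b::euclidean_space"
  shows "1-lipschitz_on UNIV v \<Longrightarrow> v \<in> borel_measurable borel"
  by (intro borel_measurable_continuous_onI lipschitz_on_continuous_on)

text \<open>A transport of finite cost may have marginals without first moments, so the integral of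
  \<open>v (fst z) - v (snd z)\<close> cannot be split. Composing \<open>v\<close> with the nearest point projection onto a large
  ball keeps it Lipschitz and makes it bounded, and \<open>norm (fst z - snd z)\<close> dominates uniformly.\<close>

lemma pairing_lipschitz:
  fixes v :: "'a::euclidean_space \<Rightarrow> 'b::euclidean_space"
  assumes M: "vector_density \<nu> M h" and P: "vector_density \<pi> P k"
    and marg: "\<forall>B\<in>sets borel. marginal1 \<pi> B - marginal2 \<pi> B = \<nu> B"
    and v: "1-lipschitz_on UNIV v"
    and intM: "integrable M (\<lambda>x. norm (v x) * norm (h x))"
    and intP: "integrable P (\<lambda>z. norm (fst z - snd z) * norm (k z))"
  shows "(\<integral>x. v x \<bullet> h x \<partial>M) = (\<integral>z. (v (fst z) - v (snd z)) \<bullet> k z \<partial>P)"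
proof -
  note M' = vector_densityD[OF M] and P' = vector_densityD[OF P]
  note fs = measurable_fst_snd_borel[OF P'(1)]
  define r where "r j = closest_point (cball (0::'b) (real j))" for j
  have cb: "convex (cball (0::'b) (real j))" "closed (cball (0::'b) (real j))" "cball (0::'b) (real j) \<noteq> {}" for j
    by auto
  have r_lip: "dist (r j y) (r j z) \<le> dist y z" for j y z
    unfolding r_def by (rule closest_point_lipschitz[OF cb])
  have r_in: "norm (r j y) \<le> real j" for j y
    using closest_point_in_set[OF cb(2,3), of j y] by (simp add: r_def)
  have r_self: "r j y = y" if "norm y \<le> real j" for j y
    unfolding r_def using that by (intro closest_point_self) simp
  have r_le: "norm (r j y) \<le> norm y" for j y
    using r_lip[of j y 0] r_self[of 0 j] by simp
  have r_lim: "(\<lambda>j. r j y) \<longlonglongrightarrow> y" for y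
  proof (rule tendsto_eventually)
    show "\<forall>\<^sub>F j in sequentially. r j y = y"
      using eventually_ge_at_top[of "nat \<lceil>norm y\<rceil>"]
      by eventually_elim (rule r_self, linarith)
  qed
  have v1: "norm (v x - v y) \<le> norm (x - y)" for x y
    using lipschitz_onD[OF v, of x y] by (simp add: dist_norm)
  have lip: "1-lipschitz_on UNIV (\<lambda>x. r j (v x))" for j
    using order_trans[OF r_lip v1[folded dist_norm]] by (intro lipschitz_onI) simp_all
  have vm: "v \<in> borel_measurable borel" and rvm: "(\<lambda>x. r j (v x)) \<in> borel_measurable borel" for j
    using lipschitz_borel_measurable[OF v] lipschitz_borel_measurable[OF lip] by auto
  have eq: "(\<integral>x. r j (v x) \<bullet> h x \<partial>M) = (\<integral>z. (r j (v (fst z)) - r j (v (snd z))) \<bullet> k z \<partial>P)" for j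
    by (rule pairing_bounded[OF M P marg rvm r_in])
  have "(\<lambda>j. \<integral>x. r j (v x) \<bullet> h x \<partial>M) \<longlonglongrightarrow> (\<integral>x. v x \<bullet> h x \<partial>M)"
    using vm rvm measurable_cong_sets[OF M'(1) refl]
    by (intro tendsto_integral_inner[where w="\<lambda>x. norm (v x)"] r_lim r_le M'(5) intM) blast+
  moreover have "(\<lambda>j. \<integral>z. (r j (v (fst z)) - r j (v (snd z))) \<bullet> k z \<partial>P) \<longlonglongrightarrow> (\<integral>z. (v (fst z) - v (snd z)) \<bullet> k z \<partial>P)"
  proof (rule tendsto_integral_inner[OF intP P'(5)])
    show "(\<lambda>z. r j (v (fst z)) - r j (v (snd z))) \<in> borel_measurable P" for j
      by (intro borel_measurable_diff measurable_compose[OF _ rvm] fs)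
    show "(\<lambda>z. v (fst z) - v (snd z)) \<in> borel_measurable P"
      by (intro borel_measurable_diff measurable_compose[OF _ vm] fs)
    show "norm (r j (v (fst z)) - r j (v (snd z))) \<le> norm (fst z - snd z)" for j z
      using r_lip[of j "v (fst z)" "v (snd z)"] v1[of "fst z" "snd z"] by (simp add: dist_norm)
    show "(\<lambda>j. r j (v (fst z)) - r j (v (snd z))) \<longlonglongrightarrow> v (fst z) - v (snd z)" for z
      by (intro tendsto_diff r_lim)
  qed
  ultimately show ?thesis unfolding eq by (rule LIMSEQ_unique)
qed

text \<open>By \<open>pairing_lipschitz\<close>, the left-hand side is the integral of \<open>v (fst z) - v (snd z)\<close> against \<open>\<pi>\<close>, whose
  density against its total variation has norm at most one.\<close>

lemma pairing_le_cost:
  fixes v :: "real ^ 'n \<Rightarrow> real ^ 'm"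
  assumes M: "vector_density \<nu> M h" and \<pi>: "\<pi> \<in> transports \<nu>" and v: "1-lipschitz_on UNIV v"
    and intM: "integrable M (\<lambda>x. norm (v x) * norm (h x))"
  shows "ennreal (\<integral>x. v x \<bullet> h x \<partial>M) \<le> transport_cost \<pi>"
proof (cases "transport_cost \<pi> < \<infinity>")
  case False
  thus ?thesis by (simp add: less_top[symmetric])
next
  case True
  let ?P = "total_variation \<pi>"
  have vm: "vector_measure \<pi>" and marg: "\<forall>B\<in>sets borel. marginal1 \<pi> B - marginal2 \<pi> B = \<nu> B"
    using \<pi> by (auto simp: transports_def)
  obtain k where k: "\<forall>x. norm (k x) \<le> 1" "vector_density \<pi> ?P k"
    using total_variation_density[OF vm] by blast
  note fs [measurable] = measurable_fst_snd_borel[OF sets_total_variation[of \<pi>]]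
  have km [measurable]: "k \<in> borel_measurable ?P" by (rule vector_densityD(5)[OF k(2)])
  have vb: "v \<in> borel_measurable borel" by (rule lipschitz_borel_measurable[OF v])
  have [measurable]: "(\<lambda>z. v (fst z)) \<in> borel_measurable ?P" "(\<lambda>z. v (snd z)) \<in> borel_measurable ?P"
    by (intro measurable_compose[OF _ vb] fs)+
  have int: "integrable ?P (\<lambda>z. norm (fst z - snd z))"
    using True unfolding transport_cost_def by (intro integrableI_nonneg) auto
  have le: "norm (fst z - snd z) * norm (k z) \<le> norm (fst z - snd z)" for z
    using mult_left_mono[of "norm (k z)" 1 "norm (fst z - snd z)"] k(1) by simp
  have intk: "integrable ?P (\<lambda>z. norm (fst z - snd z) * norm (k z))"
    by (rule Bochner_Integration.integrable_bound[OF int]) (use le in \<open>auto simp: abs_mult\<close>)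
  have b: "norm ((v (fst z) - v (snd z)) \<bullet> k z) \<le> norm (fst z - snd z)" for z
  proof -
    have "norm ((v (fst z) - v (snd z)) \<bullet> k z) \<le> norm (v (fst z) - v (snd z)) * norm (k z)"
      by (simp add: Cauchy_Schwarz_ineq2)
    also have "\<dots> \<le> norm (fst z - snd z) * norm (k z)"
      using lipschitz_onD[OF v, of "fst z" "snd z"] by (intro mult_right_mono) (auto simp: dist_norm)
    finally show ?thesis using le[of z] by linarith
  qed
  have "(\<integral>x. v x \<bullet> h x \<partial>M) = (\<integral>z. (v (fst z) - v (snd z)) \<bullet> k z \<partial>?P)"
    by (rule pairing_lipschitz[OF M k(2) marg v intM intk])
  also have "\<dots> \<le> (\<integral>z. norm (fst z - snd z) \<partial>?P)"
  proof (rule integral_mono)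
    show "integrable ?P (\<lambda>z. (v (fst z) - v (snd z)) \<bullet> k z)"
      by (rule Bochner_Integration.integrable_bound[OF int]) (use b in auto)
    show "(v (fst z) - v (snd z)) \<bullet> k z \<le> norm (fst z - snd z)" for z using b[of z] by simp
  qed (rule int)
  finally have "ennreal (\<integral>x. v x \<bullet> h x \<partial>M) \<le> ennreal (\<integral>z. norm (fst z - snd z) \<partial>?P)" by (rule ennreal_leI)
  also have "\<dots> = transport_cost \<pi>"
    unfolding transport_cost_def by (rule nn_integral_eq_integral[symmetric, OF int]) simp
  finally show ?thesis .
qed

section \<open>Estimates of transport costs\<close>

text \<open>Subadditivity of the total variation is a setwise inequality; comparing simple integrals carries it
  over to integrals, and so to transport costs.\<close>

lemma nn_integral_le_add_measure:
  assumes s: "sets M1 = sets N" "sets M2 = sets N"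
    and le: "\<And>B. B \<in> sets N \<Longrightarrow> emeasure N B \<le> emeasure M1 B + emeasure M2 B"
  shows "(\<integral>\<^sup>+x. f x \<partial>N) \<le> (\<integral>\<^sup>+x. f x \<partial>M1) + (\<integral>\<^sup>+x. f x \<partial>M2)"
  unfolding nn_integral_def[of N]
proof (rule SUP_least)
  fix g assume "g \<in> {g. simple_function N g \<and> g \<le> f}"
  hence g: "simple_function N g" "g \<le> f" by auto
  have sp: "space M1 = space N" "space M2 = space N" using s sets_eq_imp_space_eq by blast+
  have g': "simple_function M1 g" "simple_function M2 g"
    using g(1) s sp by (simp_all add: simple_function_def)
  have "integral\<^sup>S N g = (\<Sum>y\<in>g ` space N. y * emeasure N (g -` {y} \<inter> space N))"
    by (simp add: simple_integral_def)
  also have "\<dots> \<le> (\<Sum>y\<in>g ` space N. y * (emeasure M1 (g -` {y} \<inter> space N) + emeasure M2 (g -` {y} \<inter> space N)))"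
    by (intro sum_mono mult_left_mono le simple_functionD(2)[OF g(1)]) simp
  also have "\<dots> = integral\<^sup>S M1 g + integral\<^sup>S M2 g"
    by (simp add: simple_integral_def sp distrib_left sum.distrib)
  also have "\<dots> \<le> (\<integral>\<^sup>+x. f x \<partial>M1) + (\<integral>\<^sup>+x. f x \<partial>M2)"
    unfolding nn_integral_def using g' g(2) by (intro add_mono SUP_upper) auto
  finally show "integral\<^sup>S N g \<le> (\<integral>\<^sup>+x. f x \<partial>M1) + (\<integral>\<^sup>+x. f x \<partial>M2)" .
qed

lemma vector_measure_add:
  "vector_measure \<mu> \<Longrightarrow> vector_measure \<nu> \<Longrightarrow> vector_measure (\<lambda>B. \<mu> B + \<nu> B)"
  unfolding vector_measure_def by (simp add: sums_add)

lemma vector_measure_vimage: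
  fixes g :: "'a::topological_space \<Rightarrow> 'c::topological_space"
  assumes \<mu>: "vector_measure \<mu>" and g: "g \<in> borel_measurable borel"
  shows "vector_measure (\<lambda>B. \<mu> (g -` B))"
  unfolding vector_measure_def
proof (intro allI impI)
  fix E :: "nat \<Rightarrow> 'c set" assume E: "range E \<subseteq> sets borel" "disjoint_family E"
  have "g -` E i \<in> sets borel" for i using measurable_sets[OF g, of "E i"] E(1) by auto
  hence "range (\<lambda>i. g -` E i) \<subseteq> sets borel" by (simp add: image_subset_iff)
  moreover have "disjoint_family (\<lambda>i. g -` E i)" using E(2) by (rule disjoint_family_on_vimageI)
  ultimately have "(\<lambda>i. \<mu> (g -` E i)) sums \<mu> (\<Union>i. g -` E i)" by (rule vector_measure_sums[OF \<mu>])
  thus "(\<lambda>i. \<mu> (g -` E i)) sums \<mu> (g -` (\<Union>i. E i))" by (simp only: vimage_UN)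
qed

lemma vector_measure_point:
  "vector_measure (\<lambda>B. indicator B z *\<^sub>R (c::'b::real_normed_vector))"
  unfolding vector_measure_def
proof (intro allI impI)
  fix E :: "nat \<Rightarrow> 'a set" assume "disjoint_family E"
  hence "(\<lambda>i. indicat_real (E i) z) sums indicat_real (\<Union>i. E i) z"
    by (intro indicator_sums) (auto simp: disjoint_family_on_def)
  thus "(\<lambda>i. indicat_real (E i) z *\<^sub>R c) sums (indicat_real (\<Union>i. E i) z *\<^sub>R c)"
    by (rule sums_scaleR_left)
qed

lemma total_variation_add_le:
  assumes \<mu>: "vector_measure \<mu>" and \<nu>: "vector_measure \<nu>" and B: "B \<in> sets borel"
  shows "emeasure (total_variation (\<lambda>B. \<mu> B + \<nu> B)) B
    \<le> emeasure (total_variation \<mu>) B + emeasure (total_variation \<nu>) B"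
  unfolding emeasure_total_variation[OF vector_measure_add[OF \<mu> \<nu>] B]
    emeasure_total_variation[OF \<mu> B] emeasure_total_variation[OF \<nu> B]
  unfolding variation_def[of "\<lambda>B. \<mu> B + \<nu> B"]
proof (rule SUP_least)
  fix E assume E: "E \<in> borel_partitions B"
  have "variation_sum (\<lambda>B. \<mu> B + \<nu> B) E \<le> (\<Sum>i. ennreal (norm (\<mu> (E i))) + ennreal (norm (\<nu> (E i))))"
    unfolding variation_sum_def
    by (intro suminf_le summableI) (simp add: norm_triangle_ineq ennreal_leI flip: ennreal_plus)
  also have "\<dots> = variation_sum \<mu> E + variation_sum \<nu> E"
    unfolding variation_sum_def by (intro suminf_add[symmetric] summableI)
  also have "\<dots> \<le> variation \<mu> B + variation \<nu> B"
    unfolding variation_def using E by (intro add_mono SUP_upper)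
  finally show "variation_sum (\<lambda>B. \<mu> B + \<nu> B) E \<le> variation \<mu> B + variation \<nu> B" .
qed

lemma transport_cost_add:
  assumes "vector_measure \<pi>" "vector_measure \<rho>"
  shows "transport_cost (\<lambda>B. \<pi> B + \<rho> B) \<le> transport_cost \<pi> + transport_cost \<rho>"
  unfolding transport_cost_def
  by (rule nn_integral_le_add_measure) (simp_all add: total_variation_add_le[OF assms])

lemma transport_cost_le:
  assumes "vector_measure \<pi>" "sets N = sets borel"
    and "\<And>B. B \<in> sets borel \<Longrightarrow> ennreal (norm (\<pi> B)) \<le> emeasure N B"
  shows "transport_cost \<pi> \<le> (\<integral>\<^sup>+z. ennreal (norm (fst z - snd z)) \<partial>N)"
proof -
  have "transport_cost \<pi> \<le> (\<integral>\<^sup>+z. ennreal (norm (fst z - snd z)) \<partial>N) + (\<integral>\<^sup>+z. ennreal (norm (fst z - snd z)) \<partial>null_measure N)"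
    unfolding transport_cost_def
    by (rule nn_integral_le_add_measure) (use total_variation_least[OF assms] assms(2) in auto)
  also have "(\<integral>\<^sup>+z. ennreal (norm (fst z - snd z)) \<partial>null_measure N) = 0"
    by (simp add: nn_integral_null_measure)
  finally show ?thesis by simp
qed

lemma transport_cost_point:
  "transport_cost (\<lambda>B. indicator B (x, y) *\<^sub>R c) \<le> ennreal (norm c * norm (x - y))"
proof -
  \<comment> \<open>the Dirac measure at \<open>(x, y)\<close> with mass \<open>norm c\<close>\<close>
  define N :: "((real ^ 'a) \<times> (real ^ 'a)) measure" where
    "N = scale_measure (ennreal (norm c)) (distr (count_space (UNIV :: unit set)) borel (\<lambda>_. (x, y)))"
  have "transport_cost (\<lambda>B. indicator B (x, y) *\<^sub>R c) \<le> (\<integral>\<^sup>+z. ennreal (norm (fst z - snd z)) \<partial>N)"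
  proof (rule transport_cost_le[OF vector_measure_point])
    show "sets N = sets borel" by (simp add: N_def)
    fix B :: "((real ^ 'a) \<times> (real ^ 'a)) set" assume "B \<in> sets borel"
    thus "ennreal (norm (indicat_real B (x, y) *\<^sub>R c)) \<le> emeasure N B"
      by (auto simp: N_def emeasure_distr indicator_def)
  qed
  also have "\<dots> = ennreal (norm c) * ennreal (norm (x - y))"
    unfolding N_def
    by (subst nn_integral_scale_measure; (subst nn_integral_distr)?) 
       (auto simp: nn_integral_count_space_finite borel_measurable_continuous_onI continuous_intros)
  finally show ?thesis by (simp add: ennreal_mult)
qed

lemma transport_cost_graph:
  fixes T :: "real ^ 'n \<Rightarrow> real ^ 'n" and \<mu> :: "(real ^ 'n) set \<Rightarrow> real ^ 'm"
  assumes \<mu>: "vector_measure \<mu>" and T: "T \<in> borel_measurable borel"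
  shows "transport_cost (\<lambda>B. \<mu> ((\<lambda>x. (x, T x)) -` B)) \<le> (\<integral>\<^sup>+x. ennreal (norm (x - T x)) \<partial>total_variation \<mu>)"
proof -
  have g: "(\<lambda>x. (x, T x)) \<in> borel_measurable borel"
    using T by (intro borel_measurable_Pair) auto
  have g': "(\<lambda>x. (x, T x)) \<in> borel_measurable (total_variation \<mu>)"
    using g measurable_cong_sets[OF sets_total_variation[of \<mu>] refl] by blast
  let ?N = "distr (total_variation \<mu>) borel (\<lambda>x. (x, T x))"
  have "transport_cost (\<lambda>B. \<mu> ((\<lambda>x. (x, T x)) -` B)) \<le> (\<integral>\<^sup>+z. ennreal (norm (fst z - snd z)) \<partial>?N)"
  proof (rule transport_cost_le[OF vector_measure_vimage[OF \<mu> g]])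
    fix B :: "((real ^ 'n) \<times> (real ^ 'n)) set" assume B: "B \<in> sets borel"
    have "(\<lambda>x. (x, T x)) -` B \<in> sets borel" using measurable_sets[OF g B] by simp
    from norm_le_total_variation[OF \<mu> this]
    show "ennreal (norm (\<mu> ((\<lambda>x. (x, T x)) -` B))) \<le> emeasure ?N B"
      using B g' by (simp add: emeasure_distr)
  qed simp
  also have "\<dots> = (\<integral>\<^sup>+x. ennreal (norm (x - T x)) \<partial>total_variation \<mu>)"
    using g' by (subst nn_integral_distr) (auto intro!: borel_measurable_continuous_onI continuous_intros)
  finally show ?thesis .
qed

section \<open>A Hahn--Banach theorem for functions with pointwise operations\<close>

text \<open>Finitely supported measures are functions on sets, so sublinear functionals are considered on
  spaces of functions with pointwise operations. Only an inequality is demanded for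
  multiplication by scalars, since the equality follows and the inequality is easier to check for infima.\<close>

definition sublinear_on :: "('i \<Rightarrow> 'b::real_vector) set \<Rightarrow> (('i \<Rightarrow> 'b) \<Rightarrow> real) \<Rightarrow> bool" where
  "sublinear_on V q \<longleftrightarrow>
     (\<forall>x\<in>V. \<forall>y\<in>V. q (\<lambda>i. x i + y i) \<le> q x + q y) \<and>
     (\<forall>x\<in>V. \<forall>t\<ge>0. q (\<lambda>i. t *\<^sub>R x i) \<le> t * q x)"

definition linear_space :: "('i \<Rightarrow> 'b::real_vector) set \<Rightarrow> bool" where
  "linear_space V \<longleftrightarrow> V \<noteq> {} \<and> (\<forall>x\<in>V. \<forall>y\<in>V. (\<lambda>i. x i + y i) \<in> V) \<and> (\<forall>x\<in>V. \<forall>t. (\<lambda>i. t *\<^sub>R x i) \<in> V)"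

lemma linear_spaceD:
  assumes "linear_space V"
  shows "x \<in> V \<Longrightarrow> y \<in> V \<Longrightarrow> (\<lambda>i. x i + y i) \<in> V" "x \<in> V \<Longrightarrow> (\<lambda>i. t *\<^sub>R x i) \<in> V"
    "x \<in> V \<Longrightarrow> (\<lambda>i. - x i) \<in> V" "(\<lambda>i. 0) \<in> V"
proof -
  show a: "x \<in> V \<Longrightarrow> y \<in> V \<Longrightarrow> (\<lambda>i. x i + y i) \<in> V" and s: "x \<in> V \<Longrightarrow> (\<lambda>i. t *\<^sub>R x i) \<in> V" for x y t
    using assms by (simp_all add: linear_space_def)
  show "x \<in> V \<Longrightarrow> (\<lambda>i. - x i) \<in> V" using s[of x "-1"] by simp
  obtain z where "z \<in> V" using assms by (auto simp: linear_space_def)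
  from s[OF this, of 0] show "(\<lambda>i. 0) \<in> V" by simp
qed

lemma sublinear_onD:
  assumes V: "linear_space V" and q: "sublinear_on V q"
  shows "x \<in> V \<Longrightarrow> y \<in> V \<Longrightarrow> q (\<lambda>i. x i + y i) \<le> q x + q y"
    and "x \<in> V \<Longrightarrow> t \<ge> 0 \<Longrightarrow> q (\<lambda>i. t *\<^sub>R x i) = t * q x"
    and "x \<in> V \<Longrightarrow> - q (\<lambda>i. - x i) \<le> q x"
    and "q (\<lambda>i. 0) = 0"
proof -
  show add: "x \<in> V \<Longrightarrow> y \<in> V \<Longrightarrow> q (\<lambda>i. x i + y i) \<le> q x + q y" for x y
    using q by (simp add: sublinear_on_def)
  have le: "x \<in> V \<Longrightarrow> t \<ge> 0 \<Longrightarrow> q (\<lambda>i. t *\<^sub>R x i) \<le> t * q x" for x t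
    using q by (simp add: sublinear_on_def)
  note V0 = linear_spaceD(4)[OF V]
  show q0: "q (\<lambda>i. 0) = 0"
    using le[OF V0, of 0] add[OF V0 V0] by simp
  show "x \<in> V \<Longrightarrow> t \<ge> 0 \<Longrightarrow> q (\<lambda>i. t *\<^sub>R x i) = t * q x"
  proof (cases "t = 0")
    case False
    assume x: "x \<in> V" and t: "t \<ge> 0"
    have "q x \<le> inverse t * q (\<lambda>i. t *\<^sub>R x i)"
      using le[OF linear_spaceD(2)[OF V x, of t], of "inverse t"] t False by simp
    hence "t * q x \<le> q (\<lambda>i. t *\<^sub>R x i)" using t False by (simp add: field_simps)
    with le[OF x t] show ?thesis by simp
  qed (simp add: q0)
  assume x: "x \<in> V"
  have "0 \<le> q x + q (\<lambda>i. - x i)"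
    using add[OF x linear_spaceD(3)[OF V x]] q0 by simp
  thus "- q (\<lambda>i. - x i) \<le> q x" by simp
qed

text \<open>The largest sublinear functional below \<open>q\<close> that takes at \<open>- y\<close> a value of at most \<open>- q y\<close>. A minimal
  sublinear functional equals all of its tilts, and this is additivity.\<close>

definition tilt :: "(('i \<Rightarrow> 'b::real_vector) \<Rightarrow> real) \<Rightarrow> ('i \<Rightarrow> 'b) \<Rightarrow> ('i \<Rightarrow> 'b) \<Rightarrow> real" where
  "tilt q y x = (INF t\<in>{0..}. q (\<lambda>i. x i + t *\<^sub>R y i) - t * q y)"

lemma tilt_sublinear:
  assumes V: "linear_space V" and q: "sublinear_on V q" and y: "y \<in> V"
  shows "sublinear_on V (tilt q y)"
    and "x \<in> V \<Longrightarrow> t \<ge> 0 \<Longrightarrow> tilt q y x \<le> q (\<lambda>i. x i + t *\<^sub>R y i) - t * q y"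
    and "x \<in> V \<Longrightarrow> tilt q y x \<le> q x"
proof -
  note V' = linear_spaceD[OF V] and q' = sublinear_onD[OF V q]
  have bdd: "bdd_below ((\<lambda>t. q (\<lambda>i. x i + t *\<^sub>R y i) - t * q y) ` {0..})" if x: "x \<in> V" for x
  proof (rule bdd_belowI2)
    fix t :: real assume t: "t \<in> {0..}"
    have "q (\<lambda>i. t *\<^sub>R y i) \<le> q (\<lambda>i. x i + t *\<^sub>R y i) + q (\<lambda>i. - x i)"
      using q'(1)[OF V'(1)[OF x V'(2)[OF y, of t]] V'(3)[OF x]] by simp
    thus "- q (\<lambda>i. - x i) \<le> q (\<lambda>i. x i + t *\<^sub>R y i) - t * q y"
      using q'(2)[OF y, of t] t by simp
  qed
  show le: "x \<in> V \<Longrightarrow> t \<ge> 0 \<Longrightarrow> tilt q y x \<le> q (\<lambda>i. x i + t *\<^sub>R y i) - t * q y" for x t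
    unfolding tilt_def by (intro cINF_lower bdd) auto
  show "x \<in> V \<Longrightarrow> tilt q y x \<le> q x" for x using le[of x 0] by simp
  have ge: "c \<le> tilt q y x" if "\<And>t. t \<ge> 0 \<Longrightarrow> c \<le> q (\<lambda>i. x i + t *\<^sub>R y i) - t * q y" for c x
    unfolding tilt_def using that by (intro cINF_greatest) auto
  show "sublinear_on V (tilt q y)"
    unfolding sublinear_on_def
  proof (intro conjI ballI allI impI)
    fix x z assume x: "x \<in> V" and z: "z \<in> V"
    have *: "tilt q y (\<lambda>i. x i + z i) \<le> (q (\<lambda>i. x i + t *\<^sub>R y i) - t * q y) + (q (\<lambda>i. z i + s *\<^sub>R y i) - s * q y)"
      if t: "t \<ge> 0" and s: "s \<ge> 0" for s t
    proof -
      have "tilt q y (\<lambda>i. x i + z i) \<le> q (\<lambda>i. (x i + z i) + (t + s) *\<^sub>R y i) - (t + s) * q y"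
        using x z s t by (intro le V') auto
      moreover have "q (\<lambda>i. (x i + t *\<^sub>R y i) + (z i + s *\<^sub>R y i)) \<le> q (\<lambda>i. x i + t *\<^sub>R y i) + q (\<lambda>i. z i + s *\<^sub>R y i)"
        using x y z by (intro q' V') auto
      moreover have "(\<lambda>i. (x i + t *\<^sub>R y i) + (z i + s *\<^sub>R y i)) = (\<lambda>i. (x i + z i) + (t + s) *\<^sub>R y i)"
        by (simp add: algebra_simps)
      ultimately show ?thesis by (simp add: algebra_simps)
    qed
    have "tilt q y (\<lambda>i. x i + z i) - (q (\<lambda>i. x i + t *\<^sub>R y i) - t * q y) \<le> tilt q y z" if "t \<ge> 0" for t
      by (intro ge) (use *[OF that] in \<open>simp add: algebra_simps\<close>)
    hence "tilt q y (\<lambda>i. x i + z i) - tilt q y z \<le> tilt q y x"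
      by (intro ge) (simp add: algebra_simps)
    thus "tilt q y (\<lambda>i. x i + z i) \<le> tilt q y x + tilt q y z" by simp
  next
    fix x and s :: real assume x: "x \<in> V" and s: "0 \<le> s"
    show "tilt q y (\<lambda>i. s *\<^sub>R x i) \<le> s * tilt q y x"
    proof (cases "s = 0")
      case True
      thus ?thesis using le[OF V'(4), of 0] q'(4) by simp
    next
      case False
      with s have s0: "s > 0" by simp
      have "tilt q y (\<lambda>i. s *\<^sub>R x i) / s \<le> tilt q y x"
      proof (rule ge)
        fix t :: real assume t: "t \<ge> 0"
        have "tilt q y (\<lambda>i. s *\<^sub>R x i) \<le> q (\<lambda>i. s *\<^sub>R x i + (s * t) *\<^sub>R y i) - (s * t) * q y"
          using s t x by (intro le V') auto
        also have "(\<lambda>i. s *\<^sub>R x i + (s * t) *\<^sub>R y i) = (\<lambda>i. s *\<^sub>R (x i + t *\<^sub>R y i))"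
          by (simp add: algebra_simps)
        also have "q \<dots> = s * q (\<lambda>i. x i + t *\<^sub>R y i)"
          using q'(2)[OF V'(1)[OF x V'(2)[OF y]] s] .
        finally have "tilt q y (\<lambda>i. s *\<^sub>R x i) \<le> (q (\<lambda>i. x i + t *\<^sub>R y i) - t * q y) * s"
          by (simp add: algebra_simps)
        thus "tilt q y (\<lambda>i. s *\<^sub>R x i) / s \<le> q (\<lambda>i. x i + t *\<^sub>R y i) - t * q y"
          using s0 by (subst pos_divide_le_eq)
      qed
      thus ?thesis using s0 by (simp add: pos_divide_le_eq mult.commute)
    qed
  qed
qed

text \<open>Zorn's lemma: the pointwise infimum of a chain is sublinear, and it is finite because every
  sublinear functional \<open>q\<close> below \<open>p\<close> satisfies \<open>- p (- x) \<le> q x\<close>.\<close>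

lemma minimal_sublinear_exists:
  assumes V: "linear_space V" and p: "sublinear_on V p"
  shows "\<exists>m. sublinear_on V m \<and> (\<forall>x\<in>V. m x \<le> p x) \<and>
    (\<forall>q. sublinear_on V q \<longrightarrow> (\<forall>z\<in>V. q z \<le> m z) \<longrightarrow> (\<forall>x\<in>V. q x = m x))"
proof -
  note V' = linear_spaceD[OF V]
  \<comment> \<open>vanishing outside \<open>V\<close> makes the pointwise order antisymmetric\<close>
  define A where "A = {q. sublinear_on V q \<and> (\<forall>x\<in>V. q x \<le> p x) \<and> (\<forall>x. x \<notin> V \<longrightarrow> q x = 0)}"
  define P where "P q r \<longleftrightarrow> (\<forall>x. r x \<le> q x)" for q r :: "('a \<Rightarrow> 'b) \<Rightarrow> real"
  have restrict: "sublinear_on V (\<lambda>x. if x \<in> V then q x else 0)" if "sublinear_on V q" for q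
    using that V' by (simp add: sublinear_on_def)
  have lower: "- p (\<lambda>i. - x i) \<le> q x" if "q \<in> A" "x \<in> V" for q x
  proof -
    have "- p (\<lambda>i. - x i) \<le> - q (\<lambda>i. - x i)" using that V'(3)[of x] by (simp add: A_def)
    also have "\<dots> \<le> q x" using that by (intro sublinear_onD(3)[OF V]) (auto simp: A_def)
    finally show ?thesis .
  qed
  have "\<exists>m\<in>A. \<forall>a\<in>A. P m a \<longrightarrow> a = m"
  proof (rule predicate_Zorn)
    show "partial_order_on A (relation_of P A)"
    proof (rule partial_order_on_relation_ofI)
      show "P q r" if "P q s" "P s r" for q r s
        using that unfolding P_def by (meson order_trans)
      show "q = r" if "P q r" "P r q" for q r
        using that unfolding P_def by (intro ext antisym) auto
    qed (simp add: P_def)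
  next
    fix C assume C: "C \<in> Chains (relation_of P A)"
    hence CA: "C \<subseteq> A" and tot: "\<And>q r. q \<in> C \<Longrightarrow> r \<in> C \<Longrightarrow> P q r \<or> P r q"
      by (auto simp: Chains_def relation_of_def)
    show "\<exists>u\<in>A. \<forall>a\<in>C. P a u"
    proof (cases "C = {}")
      case True
      have "(\<lambda>x. if x \<in> V then p x else 0) \<in> A" using restrict[OF p] by (simp add: A_def)
      thus ?thesis using True by blast
    next
      case False
      define u where "u x = (if x \<in> V then INF q\<in>C. q x else 0)" for x
      have bdd: "bdd_below ((\<lambda>q. q x) ` C)" if "x \<in> V" for x
        using lower CA that by (intro bdd_belowI2[of _ "- p (\<lambda>i. - x i)"]) auto
      have le: "u x \<le> q x" if "q \<in> C" for q x
      proof (cases "x \<in> V")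
        case True
        thus ?thesis unfolding u_def using bdd that by (auto intro: cINF_lower)
      next
        case False
        have "q x = 0" using CA that False by (auto simp: A_def)
        thus ?thesis using False by (simp add: u_def)
      qed
      have ge: "c \<le> u x" if "\<And>q. q \<in> C \<Longrightarrow> c \<le> q x" "x \<in> V" for c x
        using that False by (auto simp: u_def intro: cINF_greatest)
      have sub: "sublinear_on V q" if "q \<in> C" for q using that CA by (auto simp: A_def)
      have "sublinear_on V u"
        unfolding sublinear_on_def
      proof (intro conjI ballI allI impI)
        fix x y assume x: "x \<in> V" and y: "y \<in> V"
        have *: "u (\<lambda>i. x i + y i) \<le> q x + r y" if q: "q \<in> C" and r: "r \<in> C" for q r
        proof -
          obtain s where s: "s \<in> C" "P q s" "P r s" using tot[OF q r] q r by (auto simp: P_def)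
          have "u (\<lambda>i. x i + y i) \<le> s (\<lambda>i. x i + y i)" by (rule le[OF s(1)])
          also have "\<dots> \<le> s x + s y" by (rule sublinear_onD(1)[OF V sub[OF s(1)] x y])
          also have "\<dots> \<le> q x + r y" using s by (simp add: P_def add_mono)
          finally show ?thesis .
        qed
        have "u (\<lambda>i. x i + y i) - q x \<le> u y" if "q \<in> C" for q
          using *[OF that] by (intro ge y) (simp add: algebra_simps)
        hence "u (\<lambda>i. x i + y i) - u y \<le> u x"
          by (intro ge x) (simp add: algebra_simps)
        thus "u (\<lambda>i. x i + y i) \<le> u x + u y" by simp
      next
        fix x and t :: real assume x: "x \<in> V" and t: "0 \<le> t"
        have *: "u (\<lambda>i. t *\<^sub>R x i) \<le> t * q x" if "q \<in> C" for q
          using le[OF that, of "\<lambda>i. t *\<^sub>R x i"] sublinear_onD(2)[OF V sub[OF that] x t] by simp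
        show "u (\<lambda>i. t *\<^sub>R x i) \<le> t * u x"
        proof (cases "t = 0")
          case True
          thus ?thesis using * \<open>C \<noteq> {}\<close> by auto
        next
          case False
          with t have t0: "t > 0" by simp
          have "u (\<lambda>i. t *\<^sub>R x i) / t \<le> u x"
            using * t0 x by (intro ge) (simp_all add: pos_divide_le_eq mult.commute)
          thus ?thesis using t0 by (simp add: pos_divide_le_eq mult.commute)
        qed
      qed
      moreover have "\<forall>x\<in>V. u x \<le> p x"
      proof
        fix x assume x: "x \<in> V"
        obtain q where "q \<in> C" using False by blast
        thus "u x \<le> p x" using le[of q x] CA x by (force simp: A_def)
      qed
      ultimately have "u \<in> A" by (simp add: A_def u_def)
      thus ?thesis using le by (auto simp: P_def)
    qed
  qed
  then obtain m where m: "m \<in> A" and min: "\<And>a. a \<in> A \<Longrightarrow> P m a \<Longrightarrow> a = m" by blast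
  show ?thesis
  proof (intro exI[of _ m] conjI allI impI ballI)
    show "sublinear_on V m" using m by (simp add: A_def)
    show "m x \<le> p x" if "x \<in> V" for x using m that by (simp add: A_def)
    fix q x assume q: "sublinear_on V q" and le: "\<forall>z\<in>V. q z \<le> m z" and x: "x \<in> V"
    define q' where "q' z = (if z \<in> V then q z else 0)" for z
    have m': "\<forall>z\<in>V. m z \<le> p z" "\<forall>z. z \<notin> V \<longrightarrow> m z = 0" using m by (auto simp: A_def)
    have "q' \<in> A" using restrict[OF q] le m'(1) by (auto simp: A_def q'_def[abs_def] intro: order_trans)
    moreover have "P m q'" using le m'(2) by (simp add: P_def q'_def)
    ultimately have "q' = m" by (rule min)
    thus "q x = m x" using x by (metis q'_def)
  qed
qed

text \<open>Minimising below the tilt of \<open>p\<close> at \<open>a\<close>, rather than below \<open>p\<close>, forces equality at \<open>a\<close>.\<close>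

theorem hahn_banach_sublinear:
  assumes V: "linear_space V" and p: "sublinear_on V p" and a: "a \<in> V"
  shows "\<exists>l. (\<forall>x\<in>V. \<forall>y\<in>V. l (\<lambda>i. x i + y i) = l x + l y) \<and>
    (\<forall>x\<in>V. \<forall>t. l (\<lambda>i. t *\<^sub>R x i) = t * l x) \<and> (\<forall>x\<in>V. l x \<le> p x) \<and> l a = p a"
proof -
  note V' = linear_spaceD[OF V]
  obtain m where m: "sublinear_on V m" and mp: "\<forall>x\<in>V. m x \<le> tilt p a x"
    and min: "\<forall>q. sublinear_on V q \<longrightarrow> (\<forall>z\<in>V. q z \<le> m z) \<longrightarrow> (\<forall>x\<in>V. q x = m x)"
    using minimal_sublinear_exists[OF V tilt_sublinear(1)[OF V p a]] by blast
  note mp = mp[rule_format]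
  note m' = sublinear_onD[OF V m]
  have add: "m (\<lambda>i. x i + y i) = m x + m y" if x: "x \<in> V" and y: "y \<in> V" for x y
  proof -
    have "tilt m y x = m x"
      using tilt_sublinear(3)[OF V m y] min[rule_format, OF tilt_sublinear(1)[OF V m y] _ x] by blast
    with tilt_sublinear(2)[OF V m y x, of 1] have "m x + m y \<le> m (\<lambda>i. x i + y i)" by simp
    with m'(1)[OF x y] show ?thesis by simp
  qed
  have minus: "m (\<lambda>i. - x i) = - m x" if "x \<in> V" for x
    using add[OF that V'(3)[OF that]] m'(4) by simp
  have le: "m x \<le> p x" if "x \<in> V" for x
    using mp[OF that] tilt_sublinear(3)[OF V p a that] by simp
  show ?thesis
  proof (intro exI[of _ m] conjI allI ballI)
    show "m (\<lambda>i. t *\<^sub>R x i) = t * m x" if x: "x \<in> V" for x t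
    proof (cases "t \<ge> 0")
      case True
      thus ?thesis by (rule m'(2)[OF x])
    next
      case False
      hence "m (\<lambda>i. (- t) *\<^sub>R x i) = - t * m x" by (intro m'(2)[OF x]) simp
      with minus[OF V'(2)[OF x, of t]] show ?thesis by simp
    qed
    have "m (\<lambda>i. - a i) \<le> p (\<lambda>i. 0) - p a"
      using mp[OF V'(3)[OF a]] tilt_sublinear(2)[OF V p a V'(3)[OF a], of 1] by simp
    hence "p a \<le> m a" using minus[OF a] sublinear_onD(4)[OF V p] by simp
    thus "m a = p a" using le[OF a] by simp
  qed (use add le in auto)
qed

section \<open>Duality for finitely supported measures\<close>

text \<open>A list entry \<open>(c, x, y)\<close> moves the vector mass \<open>c\<close> from \<open>x\<close> to \<open>y\<close>. Lists concatenate and rescale,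
  which makes sublinearity of the induced norm immediate.\<close>

definition point_transport :: "('b \<times> 'a \<times> 'a) list \<Rightarrow> ('a \<times> 'a) set \<Rightarrow> 'b::real_vector" where
  "point_transport l B = (\<Sum>(c, x, y)\<leftarrow>l. indicator B (x, y) *\<^sub>R c)"

definition point_divergence :: "('b \<times> 'a \<times> 'a) list \<Rightarrow> 'a set \<Rightarrow> 'b::real_vector" where
  "point_divergence l B = (\<Sum>(c, x, y)\<leftarrow>l. (indicator B x - indicator B y) *\<^sub>R c)"

definition point_cost :: "('b::real_normed_vector \<times> 'a::real_normed_vector \<times> 'a) list \<Rightarrow> real" where
  "point_cost l = (\<Sum>(c, x, y)\<leftarrow>l. norm c * norm (x - y))"

lemma point_cost_nonneg: "0 \<le> point_cost l"
  unfolding point_cost_def by (rule sum_list_nonneg) auto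

lemma point_transport_marginals:
  "marginal1 (point_transport l) B - marginal2 (point_transport l) B = point_divergence l B"
proof (induction l)
  case (Cons a l)
  obtain c x y where a: "a = (c, x, y)" by (cases a)
  have "marginal1 (point_transport (a # l)) B - marginal2 (point_transport (a # l)) B
      = (indicator B x - indicator B y) *\<^sub>R c + (marginal1 (point_transport l) B - marginal2 (point_transport l) B)"
    by (simp add: a marginal1_def marginal2_def point_transport_def indicator_times scaleR_diff_left)
  thus ?case unfolding Cons by (simp add: a point_divergence_def)
qed (simp add: marginal1_def marginal2_def point_transport_def point_divergence_def)

lemma point_transport_measure_cost:
  fixes l :: "((real ^ 'm) \<times> (real ^ 'n) \<times> (real ^ 'n)) list"
  shows "vector_measure (point_transport l) \<and> transport_cost (point_transport l) \<le> ennreal (point_cost l)"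
proof (induction l)
  case Nil
  have 0: "vector_measure (\<lambda>B :: ((real ^ 'n) \<times> (real ^ 'n)) set. 0 :: real ^ 'm)"
    by (simp add: vector_measure_def)
  have "transport_cost (\<lambda>B :: ((real ^ 'n) \<times> (real ^ 'n)) set. 0 :: real ^ 'm)
      \<le> (\<integral>\<^sup>+z. ennreal (norm (fst z - snd z)) \<partial>null_measure (borel :: ((real ^ 'n) \<times> (real ^ 'n)) measure))"
    by (rule transport_cost_le[OF 0]) simp_all
  hence "transport_cost (\<lambda>B :: ((real ^ 'n) \<times> (real ^ 'n)) set. 0 :: real ^ 'm) = 0"
    by (simp add: nn_integral_null_measure)
  with 0 show ?case by (simp add: point_transport_def[abs_def])
next
  case (Cons a l)
  obtain c x y where a: "a = (c, x, y)" by (cases a)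
  have eq: "point_transport (a # l) = (\<lambda>B. indicator B (x, y) *\<^sub>R c + point_transport l B)"
    by (simp add: a point_transport_def fun_eq_iff)
  have "transport_cost (point_transport (a # l)) \<le> transport_cost (\<lambda>B. indicator B (x, y) *\<^sub>R c) + transport_cost (point_transport l)"
    unfolding eq using Cons by (intro transport_cost_add vector_measure_point) auto
  also have "\<dots> \<le> ennreal (norm c * norm (x - y)) + ennreal (point_cost l)"
    using Cons by (intro add_mono transport_cost_point) auto
  also have "\<dots> = ennreal (point_cost (a # l))"
    using point_cost_nonneg[of l] by (simp add: a point_cost_def flip: ennreal_plus)
  finally show ?case
    unfolding eq using Cons by (auto intro!: vector_measure_add vector_measure_point)
qed

text \<open>The counterpart of \<^const>\<open>wasserstein_norm\<close> that admits finitely supported transports only. It is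
  meaningful on the range of \<^const>\<open>point_divergence\<close>, where the infimum is over a nonempty set.\<close>

definition point_norm :: "('a::real_normed_vector set \<Rightarrow> 'b::real_normed_vector) \<Rightarrow> real" where
  "point_norm a = (INF l\<in>{l. point_divergence l = a}. point_cost l)"

lemma point_norm_le: "point_norm (point_divergence l) \<le> point_cost l"
  unfolding point_norm_def
  by (rule cINF_lower) (auto intro!: bdd_belowI2[of _ 0] point_cost_nonneg)

lemma point_norm_approx:
  assumes "e > 0"
  shows "\<exists>l'. point_divergence l' = point_divergence l \<and> point_cost l' < point_norm (point_divergence l) + e"
proof -
  have "\<exists>x\<in>point_cost ` {l'. point_divergence l' = point_divergence l}. x < point_norm (point_divergence l) + e"
  proof (rule cInf_lessD)
    show "Inf (point_cost ` {l'. point_divergence l' = point_divergence l}) < point_norm (point_divergence l) + e"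
      using assms by (simp add: point_norm_def)
  qed auto
  thus ?thesis by auto
qed

lemma point_divergence_append: "point_divergence (l @ l') B = point_divergence l B + point_divergence l' B"
  by (simp add: point_divergence_def)

lemma point_divergence_scale:
  "point_divergence (map (\<lambda>(c, xy). (t *\<^sub>R c, xy)) l) B = t *\<^sub>R point_divergence l B"
  by (induction l) (auto simp: point_divergence_def scaleR_add_right)

lemma point_cost_scale:
  "t \<ge> 0 \<Longrightarrow> point_cost (map (\<lambda>(c, xy). (t *\<^sub>R c, xy)) l) = t * point_cost l"
  by (induction l) (auto simp: point_cost_def algebra_simps)

lemma linear_space_point_divergence: "linear_space (range point_divergence)"
  unfolding linear_space_def
proof (intro conjI ballI allI)
  fix x y :: "'a set \<Rightarrow> 'b" and t :: real
  assume "x \<in> range point_divergence" "y \<in> range point_divergence"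
  then obtain l l' where l: "x = point_divergence l" "y = point_divergence l'" by auto
  have "(\<lambda>i. x i + y i) = point_divergence (l @ l')"
    by (simp add: l fun_eq_iff point_divergence_append)
  thus "(\<lambda>i. x i + y i) \<in> range point_divergence" by simp
next
  fix x :: "'a set \<Rightarrow> 'b" and t :: real
  assume "x \<in> range point_divergence"
  then obtain l where l: "x = point_divergence l" by auto
  have "(\<lambda>i. t *\<^sub>R x i) = point_divergence (map (\<lambda>(c, xy). (t *\<^sub>R c, xy)) l)"
    unfolding l fun_eq_iff by (simp only: point_divergence_scale) simp
  thus "(\<lambda>i. t *\<^sub>R x i) \<in> range point_divergence" by simp
qed auto

lemma sublinear_on_point_norm:
  "sublinear_on (range point_divergence)
     (point_norm :: ('a::real_normed_vector set \<Rightarrow> 'b::real_normed_vector) \<Rightarrow> real)"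
  unfolding sublinear_on_def
proof (intro conjI ballI allI impI)
  fix x y :: "'a set \<Rightarrow> 'b"
  assume "x \<in> range point_divergence" "y \<in> range point_divergence"
  then obtain l l' where l: "x = point_divergence l" "y = point_divergence l'" by auto
  show "point_norm (\<lambda>i. x i + y i) \<le> point_norm x + point_norm y"
  proof (rule field_le_epsilon)
    fix e :: real assume "e > 0"
    hence e: "e / 2 > 0" by simp
    obtain k where k: "point_divergence k = x" "point_cost k < point_norm x + e / 2"
      using point_norm_approx[OF e, of l] unfolding l by auto
    obtain k' where k': "point_divergence k' = y" "point_cost k' < point_norm y + e / 2"
      using point_norm_approx[OF e, of l'] unfolding l by auto
    have "(\<lambda>i. x i + y i) = point_divergence (k @ k')"
      by (simp add: fun_eq_iff point_divergence_append k(1) k'(1))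
    hence "point_norm (\<lambda>i. x i + y i) \<le> point_cost (k @ k')" by (simp add: point_norm_le)
    also have "\<dots> = point_cost k + point_cost k'" by (simp add: point_cost_def)
    finally show "point_norm (\<lambda>i. x i + y i) \<le> point_norm x + point_norm y + e" using k(2) k'(2) by simp
  qed
next
  fix x :: "'a set \<Rightarrow> 'b" and t :: real
  assume "x \<in> range point_divergence" and t: "0 \<le> t"
  then obtain l where l: "x = point_divergence l" by auto
  show "point_norm (\<lambda>i. t *\<^sub>R x i) \<le> t * point_norm x"
  proof (rule field_le_epsilon)
    fix e :: real assume e: "e > 0"
    define d where "d = e / (t + 1)"
    have d: "d > 0" "t * d \<le> e" using e t by (simp_all add: d_def field_simps)
    obtain k where k: "point_divergence k = x" "point_cost k < point_norm x + d"
      using point_norm_approx[OF d(1), of l] unfolding l by auto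
    have "(\<lambda>i. t *\<^sub>R x i) = point_divergence (map (\<lambda>(c, xy). (t *\<^sub>R c, xy)) k)"
      unfolding fun_eq_iff by (simp only: point_divergence_scale k(1)) simp
    hence "point_norm (\<lambda>i. t *\<^sub>R x i) \<le> point_cost (map (\<lambda>(c, xy). (t *\<^sub>R c, xy)) k)"
      by (simp only: point_norm_le)
    also have "\<dots> = t * point_cost k" by (rule point_cost_scale[OF t])
    also have "\<dots> \<le> t * (point_norm x + d)" using k(2) t by (intro mult_left_mono) auto
    finally show "point_norm (\<lambda>i. t *\<^sub>R x i) \<le> t * point_norm x + e" using d(2) by (simp add: distrib_left)
  qed
qed

text \<open>A linear functional dominated by the norm is determined by its values on the measures
  \<open>c\<close> at \<open>x\<close> minus \<open>c\<close> at \<open>0\<close>. These values are linear in \<open>c\<close>, so they are inner products with a vector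
  \<open>v x\<close>, and the domination says precisely that \<open>v\<close> is 1-Lipschitz.\<close>

lemma discrete_duality:
  fixes l :: "('b::euclidean_space \<times> 'a::real_normed_vector \<times> 'a) list"
  shows "\<exists>v. 1-lipschitz_on UNIV v \<and>
    (\<Sum>(c, x, y)\<leftarrow>l. (v x - v y) \<bullet> c) = point_norm (point_divergence l)"
proof -
  let ?V = "range point_divergence :: ('a set \<Rightarrow> 'b) set"
  have "point_divergence l \<in> ?V" by simp
  then obtain L where add: "\<forall>a\<in>?V. \<forall>b\<in>?V. L (\<lambda>i. a i + b i) = L a + L b"
    and scale: "\<forall>a\<in>?V. \<forall>t. L (\<lambda>i. t *\<^sub>R a i) = t * L a"
    and le: "\<forall>a\<in>?V. L a \<le> point_norm a" and eq: "L (point_divergence l) = point_norm (point_divergence l)"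
    using hahn_banach_sublinear[OF linear_space_point_divergence sublinear_on_point_norm] by blast
  define f where "f x c = L (point_divergence [(c, x, 0)])" for x :: 'a and c :: 'b
  have lin: "linear (f x)" for x
  proof (rule linearI)
    fix c d :: 'b and t :: real
    have "point_divergence [(c + d, x, 0)] = (\<lambda>B. point_divergence [(c, x, 0)] B + point_divergence [(d, x, 0)] B)"
      by (simp add: fun_eq_iff point_divergence_def scaleR_add_right)
    thus "f x (c + d) = f x c + f x d" unfolding f_def using add by simp
    have "point_divergence [(t *\<^sub>R c, x, 0)] = (\<lambda>B. t *\<^sub>R point_divergence [(c, x, 0)] B)"
      by (simp add: fun_eq_iff point_divergence_def)
    thus "f x (t *\<^sub>R c) = t *\<^sub>R f x c" unfolding f_def using scale by simp
  qed
  define v where "v x = adjoint (f x) 1" for x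
  have v: "v x \<bullet> c = f x c" for x c
    using adjoint_works[OF lin[of x], of c 1] by (simp add: v_def inner_commute)
  have L1: "L (point_divergence [(c, x, y)]) = (v x - v y) \<bullet> c" for c x y
  proof -
    have "point_divergence [(c, x, 0)] = (\<lambda>B. point_divergence [(c, x, y)] B + point_divergence [(c, y, 0)] B)"
      by (simp add: fun_eq_iff point_divergence_def algebra_simps)
    hence "f x c = L (point_divergence [(c, x, y)]) + f y c" unfolding f_def using add by simp
    thus ?thesis by (simp add: inner_diff_left v)
  qed
  have "1-lipschitz_on UNIV v"
  proof (rule lipschitz_onI)
    fix x y
    have "norm (v x - v y) * norm (v x - v y) = (v x - v y) \<bullet> (v x - v y)"
      by (simp add: power2_norm_eq_inner flip: power2_eq_square)
    also have "\<dots> \<le> point_norm (point_divergence [(v x - v y, x, y)])"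
      using le unfolding L1[symmetric] by simp
    also have "\<dots> \<le> norm (v x - v y) * norm (x - y)"
      using point_norm_le[of "[(v x - v y, x, y)]"] by (simp add: point_cost_def)
    finally have "norm (v x - v y) \<le> norm (x - y)"
      by (cases "v x = v y") auto
    thus "dist (v x) (v y) \<le> 1 * dist x y" by (simp add: dist_norm)
  qed simp
  moreover have "L (point_divergence k) = (\<Sum>(c, x, y)\<leftarrow>k. (v x - v y) \<bullet> c)" for k
  proof (induction k)
    case Nil
    have "point_divergence [] = (\<lambda>B. 0 *\<^sub>R point_divergence ([] :: ('b \<times> 'a \<times> 'a) list) B)"
      by (simp add: fun_eq_iff point_divergence_def)
    hence "L (point_divergence []) = 0 * L (point_divergence [])" using scale by (metis rangeI)
    thus ?case by simp
  next
    case (Cons a k)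
    obtain c x y where a: "a = (c, x, y)" by (cases a)
    have "point_divergence (a # k) = (\<lambda>B. point_divergence [a] B + point_divergence k B)"
      by (simp add: fun_eq_iff point_divergence_def)
    hence "L (point_divergence (a # k)) = L (point_divergence [a]) + L (point_divergence k)"
      using add by simp
    with Cons show ?case by (simp add: a L1)
  qed
  ultimately show ?thesis using eq by metis
qed

section \<open>Duality in the Wasserstein space\<close>

lemma wasserstein_moment:
  fixes \<mu> :: "(real ^ 'n) set \<Rightarrow> real ^ 'm" and v :: "real ^ 'n \<Rightarrow> 'c::euclidean_space"
  assumes \<mu>: "\<mu> \<in> wasserstein_space" and v: "1-lipschitz_on UNIV v"
  shows "integrable (total_variation \<mu>) (\<lambda>x. norm (v x))"
proof -
  let ?M = "total_variation \<mu>"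
  obtain x0 where vm: "vector_measure \<mu>" and x0: "(\<integral>\<^sup>+x. ennreal (norm (x - x0)) \<partial>?M) < \<infinity>"
    using \<mu> by (auto simp: wasserstein_space_def)
  interpret M: finite_measure ?M by (rule finite_measure_total_variation[OF vm])
  have m: "g \<in> borel_measurable borel \<Longrightarrow> g \<in> borel_measurable ?M" for g :: "real ^ 'n \<Rightarrow> real"
    using measurable_cong_sets[OF sets_total_variation[of \<mu>] refl] by blast
  have i: "integrable ?M (\<lambda>x. norm (x - x0))"
    using x0 by (intro integrableI_nonneg m) auto
  have "integrable ?M (\<lambda>x. norm (v x0) + norm (x - x0))" using i by simp
  thus ?thesis
  proof (rule Bochner_Integration.integrable_bound)
    show "(\<lambda>x. norm (v x)) \<in> borel_measurable ?M"
      using lipschitz_borel_measurable[OF v] by (intro m) auto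
    show "AE x in ?M. norm (norm (v x)) \<le> norm (norm (v x0) + norm (x - x0))"
    proof (rule AE_I2)
      fix x
      have "norm (v x) \<le> norm (v x0) + norm (v x - v x0)" by (rule norm_triangle_sub)
      also have "norm (v x - v x0) \<le> norm (x - x0)"
        using lipschitz_onD[OF v, of x x0] by (simp add: dist_norm)
      finally show "norm (norm (v x)) \<le> norm (norm (v x0) + norm (x - x0))" by simp
    qed
  qed
qed

lemma finite_range_approximation:
  fixes \<mu> :: "(real ^ 'n) set \<Rightarrow> real ^ 'm"
  assumes \<mu>: "\<mu> \<in> wasserstein_space" and e: "e > 0"
  shows "\<exists>T. simple_function borel T \<and> integrable (total_variation \<mu>) (\<lambda>x. norm (x - T x)) \<and>
    (\<integral>x. norm (x - T x) \<partial>total_variation \<mu>) < e"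
proof -
  let ?M = "total_variation \<mu>"
  have i: "integrable ?M (\<lambda>x. norm x)"
    using wasserstein_moment[OF \<mu>, of "\<lambda>x. x"] by (simp add: lipschitz_on_def)
  have "(\<lambda>x. x) \<in> borel_measurable (borel :: (real ^ 'n) measure)" by simp
  then obtain s :: "nat \<Rightarrow> real ^ 'n \<Rightarrow> real ^ 'n" where s: "\<And>i. simple_function borel (s i)" "\<And>x. (\<lambda>i. s i x) \<longlonglongrightarrow> x"
      "\<And>i x. dist (s i x) 0 \<le> 2 * dist x 0"
    using borel_measurable_implies_sequence_metric[of "\<lambda>x. x" borel 0] unfolding space_borel by blast
  have m: "(\<lambda>x. norm (x - s i x)) \<in> borel_measurable ?M" for i
  proof -
    have "(\<lambda>x. norm (x - s i x)) \<in> borel_measurable borel"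
      using borel_measurable_simple_function[OF s(1)] by auto
    thus ?thesis using measurable_cong_sets[OF sets_total_variation[of \<mu>] refl] by blast
  qed
  have b: "norm (x - s i x) \<le> 3 * norm x" for i x
    using norm_triangle_ineq4[of x "s i x"] s(3)[of i x] by simp
  have int: "integrable ?M (\<lambda>x. norm (x - s i x))" for i
    by (rule Bochner_Integration.integrable_bound[of _ "\<lambda>x. 3 * norm x"]) (use i m b in auto)
  have "(\<lambda>i. \<integral>x. norm (x - s i x) \<partial>?M) \<longlonglongrightarrow> (\<integral>x. 0 \<partial>?M)"
  proof (rule integral_dominated_convergence[where w="\<lambda>x. 3 * norm x"])
    show "AE x in ?M. (\<lambda>i. norm (x - s i x)) \<longlonglongrightarrow> 0"
    proof (rule AE_I2)
      fix x
      have "(\<lambda>i. x - s i x) \<longlonglongrightarrow> x - x" by (intro tendsto_diff tendsto_const s(2))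
      thus "(\<lambda>i. norm (x - s i x)) \<longlonglongrightarrow> 0" by (intro tendsto_norm_zero) simp
    qed
  qed (use i m b in auto)
  hence "\<forall>\<^sub>F i in sequentially. (\<integral>x. norm (x - s i x) \<partial>?M) < e"
    using e by (intro order_tendstoD(2)[where y=0]) auto
  then obtain i where "(\<integral>x. norm (x - s i x) \<partial>?M) < e"
    by (auto simp: eventually_sequentially)
  thus ?thesis using s(1) int by blast
qed

text \<open>Push \<open>\<mu>\<close> forward under a map \<open>T\<close> with finitely many values and small mean displacement. The image
  is finitely supported, where duality is known. Its nearly optimal transport, combined with the
  movement along \<open>T\<close>, transports \<open>\<mu>\<close>; and its dual map \<open>v\<close> integrates against \<open>\<mu>\<close> almost as against
  the image. Each of the three approximations costs at most \<open>e / 3\<close>.\<close>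

lemma wasserstein_duality:
  fixes \<mu> :: "(real ^ 'n) set \<Rightarrow> real ^ 'm"
  assumes \<mu>: "\<mu> \<in> wasserstein_space" and h: "vector_density \<mu> (total_variation \<mu>) h" "\<And>x. norm (h x) \<le> 1"
    and e: "e > 0"
  shows "\<exists>v. 1-lipschitz_on UNIV v \<and> wasserstein_norm \<mu> \<le> ennreal ((\<integral>x. v x \<bullet> h x \<partial>total_variation \<mu>) + e)"
proof -
  let ?M = "total_variation \<mu>"
  have vm: "vector_measure \<mu>" and \<mu>0: "\<mu> UNIV = 0"
    using \<mu> by (auto simp: wasserstein_space_def)
  note M' = vector_densityD[OF h(1)]
  interpret M: finite_measure ?M by (rule finite_measure_total_variation[OF vm])
  have e3: "e / 3 > 0" using e by simp
  obtain T where T: "simple_function borel T" and Ti: "integrable ?M (\<lambda>x. norm (x - T x))"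
    and Te: "(\<integral>x. norm (x - T x) \<partial>?M) < e / 3"
    using finite_range_approximation[OF \<mu> e3] by blast
  have Tm: "T \<in> borel_measurable borel" by (rule borel_measurable_simple_function[OF T])
  have TM: "T \<in> borel_measurable ?M"
    using Tm measurable_cong_sets[OF sets_total_variation[of \<mu>] refl] by blast
  have fin: "finite (range T)" and Tv: "T -` {z} \<in> sets borel" for z
    using simple_functionD[OF T] by auto
  obtain zs where zs: "set zs = range T" "distinct zs" using finite_distinct_list[OF fin] by blast
  \<comment> \<open>all mass is sent to the origin; as \<open>\<mu>\<close> has total mass zero, nothing arrives there\<close>
  define l where "l = map (\<lambda>z. (\<mu> (T -` {z}), z, 0 :: real ^ 'n)) zs"
  have \<mu>T: "\<mu> (T -` B) = (\<Sum>z\<in>range T. indicator B z *\<^sub>R \<mu> (T -` {z}))" for B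
  proof -
    have "T -` B = (\<Union>z\<in>range T \<inter> B. T -` {z})" by auto
    also have "\<mu> \<dots> = (\<Sum>z\<in>range T \<inter> B. \<mu> (T -` {z}))"
      using fin Tv by (intro vector_measure_finite_UN[OF vm]) (auto simp: disjoint_family_on_def)
    also have "\<dots> = (\<Sum>z\<in>range T. indicator B z *\<^sub>R \<mu> (T -` {z}))"
      using fin by (intro sum.mono_neutral_cong_left) (auto simp: indicator_def)
    finally show ?thesis .
  qed
  have div: "point_divergence l B = \<mu> (T -` B)" for B
  proof -
    have "point_divergence l B = (\<Sum>z\<in>range T. (indicator B z - indicator B 0) *\<^sub>R \<mu> (T -` {z}))"
      using zs by (simp add: point_divergence_def l_def o_def sum_list_distinct_conv_sum_set)
    also have "\<dots> = (\<Sum>z\<in>range T. indicator B z *\<^sub>R \<mu> (T -` {z}))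
        - indicator B 0 *\<^sub>R (\<Sum>z\<in>range T. \<mu> (T -` {z}))"
      by (simp add: scaleR_diff_left sum_subtractf scaleR_sum_right)
    also have "(\<Sum>z\<in>range T. indicator B z *\<^sub>R \<mu> (T -` {z})) = \<mu> (T -` B)"
      by (rule \<mu>T[symmetric])
    also have "(\<Sum>z\<in>range T. \<mu> (T -` {z})) = 0"
      using \<mu>T[of UNIV] \<mu>0 by simp
    finally show ?thesis by simp
  qed
  obtain v where v: "1-lipschitz_on UNIV v"
    and vl: "(\<Sum>(c, x, y)\<leftarrow>l. (v x - v y) \<bullet> c) = point_norm (point_divergence l)"
    using discrete_duality[of l] by blast
  obtain k where k: "point_divergence k = point_divergence l"
    and kc: "point_cost k < point_norm (point_divergence l) + e / 3"
    using point_norm_approx[OF e3, of l] by blast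
  define \<pi> where "\<pi> B = \<mu> ((\<lambda>x. (x, T x)) -` B) + point_transport k B" for B
  have g: "(\<lambda>x. (x, T x)) \<in> borel_measurable borel"
    using Tm by (intro borel_measurable_Pair) auto
  note pt = point_transport_measure_cost[of k]
  have \<pi>v: "vector_measure \<pi>"
    unfolding \<pi>_def[abs_def] using pt by (intro vector_measure_add vector_measure_vimage[OF vm g]) auto
  have "marginal1 \<pi> B - marginal2 \<pi> B = \<mu> B" for B
  proof -
    have "marginal1 \<pi> B - marginal2 \<pi> B = \<mu> B - \<mu> (T -` B) + point_divergence k B"
      by (simp add: marginal1_def marginal2_def \<pi>_def vimage_def flip: point_transport_marginals)
    thus ?thesis by (simp add: k div)
  qed
  hence \<pi>t: "\<pi> \<in> transports \<mu>" using \<pi>v by (simp add: transports_def)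
  have "wasserstein_norm \<mu> \<le> transport_cost \<pi>"
    unfolding wasserstein_norm_def using \<pi>t by (rule INF_lower)
  also have "\<dots> \<le> transport_cost (\<lambda>B. \<mu> ((\<lambda>x. (x, T x)) -` B)) + transport_cost (point_transport k)"
    unfolding \<pi>_def[abs_def] using pt by (intro transport_cost_add vector_measure_vimage[OF vm g]) auto
  also have "\<dots> \<le> (\<integral>\<^sup>+x. ennreal (norm (x - T x)) \<partial>?M) + ennreal (point_cost k)"
    using pt by (intro add_mono transport_cost_graph[OF vm Tm]) auto
  also have "(\<integral>\<^sup>+x. ennreal (norm (x - T x)) \<partial>?M) = ennreal (\<integral>x. norm (x - T x) \<partial>?M)"
    by (rule nn_integral_eq_integral[OF Ti]) simp
  also have "\<dots> + ennreal (point_cost k) = ennreal ((\<integral>x. norm (x - T x) \<partial>?M) + point_cost k)"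
    by (simp add: point_cost_nonneg integral_nonneg_AE)
  finally have primal: "wasserstein_norm \<mu> \<le> ennreal ((\<integral>x. norm (x - T x) \<partial>?M) + point_cost k)" .
  have vb: "v \<in> borel_measurable borel" by (rule lipschitz_borel_measurable[OF v])
  have vM: "v \<in> borel_measurable ?M" and vTM: "(\<lambda>x. v (T x)) \<in> borel_measurable ?M"
    using vb measurable_cong_sets[OF sets_total_variation[of \<mu>] refl] measurable_compose[OF TM vb] by blast+
  have hM: "h \<in> borel_measurable ?M" by (rule M'(5))
  have i1: "integrable ?M (\<lambda>x. v x \<bullet> h x)"
  proof (rule Bochner_Integration.integrable_bound[OF wasserstein_moment[OF \<mu> v]])
    show "AE x in ?M. norm (v x \<bullet> h x) \<le> norm (norm (v x))"
    proof (rule AE_I2)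
      fix x show "norm (v x \<bullet> h x) \<le> norm (norm (v x))"
        using Cauchy_Schwarz_ineq2[of "v x" "h x"] mult_left_mono[OF h(2)[of x], of "norm (v x)"] by simp
    qed
  qed (use vM hM in simp)
  have b: "norm ((v (T x) - v x) \<bullet> h x) \<le> norm (x - T x)" for x
  proof -
    have "norm ((v (T x) - v x) \<bullet> h x) \<le> norm (v (T x) - v x) * norm (h x)"
      by (simp add: Cauchy_Schwarz_ineq2)
    also have "\<dots> \<le> norm (T x - x) * 1"
      using lipschitz_onD[OF v, of "T x" x] h(2)[of x] by (intro mult_mono) (auto simp: dist_norm)
    finally show ?thesis by (simp add: norm_minus_commute)
  qed
  have i2: "integrable ?M (\<lambda>x. (v (T x) - v x) \<bullet> h x)"
    by (rule Bochner_Integration.integrable_bound[OF Ti]) (use vM hM vTM b in auto)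
  have i3: "integrable ?M (\<lambda>x. v 0 \<bullet> h x)" using M'(2) by simp
  have UN: "(\<integral>x. v 0 \<bullet> h x \<partial>?M) = 0"
    using M'(2) M'(3)[of UNIV] \<mu>0 by (simp add: set_lebesgue_integral_def)
  \<comment> \<open>subtracting the constant \<open>v 0\<close> is harmless, again because \<open>\<mu>\<close> has total mass zero\<close>
  have "point_norm (point_divergence l) = (\<Sum>z\<in>range T. (v z - v 0) \<bullet> \<mu> (T -` {z}))"
    using zs vl by (simp add: l_def o_def sum_list_distinct_conv_sum_set)
  also have "\<dots> = (\<integral>x. (v (T x) - v 0) \<bullet> h x \<partial>?M)"
    using integral_finite_range[OF fin _ M'(2), of "\<lambda>z. v z - v 0"] Tv M'(3) by simp
  also have "\<dots> = (\<integral>x. (v (T x) - v x) \<bullet> h x + v x \<bullet> h x - v 0 \<bullet> h x \<partial>?M)"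
    by (simp add: inner_diff_left)
  also have "\<dots> = (\<integral>x. (v (T x) - v x) \<bullet> h x \<partial>?M) + (\<integral>x. v x \<bullet> h x \<partial>?M)"
    using i1 i2 i3 UN by simp
  also have "(\<integral>x. (v (T x) - v x) \<bullet> h x \<partial>?M) \<le> (\<integral>x. norm (x - T x) \<partial>?M)"
    by (intro integral_mono i2 Ti) (use b in \<open>auto intro: order_trans[OF abs_ge_self]\<close>)
  finally have "(\<integral>x. norm (x - T x) \<partial>?M) + point_cost k \<le> (\<integral>x. v x \<bullet> h x \<partial>?M) + e"
    using kc Te by simp
  with primal have "wasserstein_norm \<mu> \<le> ennreal ((\<integral>x. v x \<bullet> h x \<partial>?M) + e)"
    using ennreal_leI order_trans by blast
  with v show ?thesis by blast
qed

section \<open>Almost every point lies on a single leaf\<close>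

text \<open>Infinitely many short translates of a bounded piece of \<open>S\<close> along \<open>f\<close> are disjoint, of equal measure,
  and contained in one ball.\<close>

lemma null_set_if_disjoint_translates:
  fixes S :: "'a::euclidean_space set"
  assumes S: "closed S" and r: "r > 0"
    and disj: "\<And>x t. x \<in> S \<Longrightarrow> 0 < t \<Longrightarrow> t \<le> r \<Longrightarrow> x + t *\<^sub>R f \<notin> S"
  shows "S \<in> null_sets lborel"
proof -
  have piece: "S \<inter> cball 0 (real R) \<in> null_sets lborel" for R :: nat
  proof -
    define K where "K = S \<inter> cball 0 (real R)"
    have K: "closed K" using S by (auto simp: K_def)
    define E where "E i = (+) ((r / Suc i) *\<^sub>R f) ` K" for i :: nat
    have Ec: "closed (E i)" for i unfolding E_def by (rule closed_translation[OF K])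
    have mE: "emeasure lborel (E i) = emeasure lborel K" for i
    proof -
      define c where "c = - ((r / Suc i) *\<^sub>R f)"
      have "E i = (\<lambda>x. x + c) -` K"
        by (force simp: E_def c_def image_iff algebra_simps)
      also have "(\<lambda>x. x + c) = (+) c" by (simp add: fun_eq_iff add.commute)
      finally have "emeasure lborel (E i) = emeasure (distr lborel borel ((+) c)) K"
        using K by (subst emeasure_distr) auto
      also have "\<dots> = emeasure lborel K" by (subst lborel_distr_plus) simp
      finally show ?thesis .
    qed
    have dE: "disjoint_family E"
      unfolding disjoint_family_on_def
    proof (intro ballI impI)
      fix i j :: nat assume "i \<noteq> j"
      have *: "E i \<inter> E j = {}" if "i < j" for i j
      proof (rule ccontr)
        assume "E i \<inter> E j \<noteq> {}"
        then obtain x y where xy: "x \<in> K" "y \<in> K" "(r / Suc i) *\<^sub>R f + x = (r / Suc j) *\<^sub>R f + y"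
          by (auto simp: E_def)
        let ?t = "r / Suc i - r / Suc j"
        have "r / Suc j < r / Suc i" using that r by (intro divide_strict_left_mono) auto
        moreover have "r / Suc i \<le> r" "0 \<le> r / Suc j" using r by (auto simp: divide_le_eq)
        ultimately have t: "0 < ?t" "?t \<le> r" by linarith+
        have "y = x + ?t *\<^sub>R f" using xy(3) by (simp add: algebra_simps)
        thus False using disj[OF _ t, of x] xy(1,2) by (simp add: K_def)
      qed
      show "E i \<inter> E j = {}"
      proof (cases "i < j")
        case False
        hence "j < i" using \<open>i \<noteq> j\<close> by simp
        from *[OF this] show ?thesis by blast
      qed (rule *)
    qed
    have sub: "(\<Union>i. E i) \<subseteq> cball 0 (real R + r * norm f)"
    proof clarify
      fix i x assume "x \<in> E i"
      then obtain y where y: "y \<in> K" "x = (r / Suc i) *\<^sub>R f + y" by (auto simp: E_def)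
      have "norm x \<le> r / Suc i * norm f + norm y"
        unfolding y(2) using norm_triangle_ineq[of "(r / Suc i) *\<^sub>R f" y] r by simp
      also have "r / Suc i * norm f \<le> r * norm f"
        using r by (intro mult_right_mono) (auto simp: divide_le_eq)
      finally show "x \<in> cball 0 (real R + r * norm f)" using y(1) by (simp add: K_def)
    qed
    have "emeasure lborel (\<Union>i. E i) \<le> emeasure lborel (cball (0::'a) (real R + r * norm f))"
      using sub by (intro emeasure_mono) auto
    also have "\<dots> < \<infinity>" using emeasure_bounded_finite[OF bounded_cball] .
    also have "emeasure lborel (\<Union>i. E i) = (\<Sum>i. emeasure lborel (E i))"
      using dE Ec by (intro suminf_emeasure[symmetric]) (auto simp: image_subset_iff)
    also have "\<dots> = (\<Sum>i::nat. emeasure lborel K)" by (simp only: mE)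
    finally have fin: "(\<Sum>i::nat. emeasure lborel K) < \<infinity>" .
    have "emeasure lborel K = 0"
    proof (rule ccontr)
      assume "emeasure lborel K \<noteq> 0"
      hence "(\<Sum>i::nat. emeasure lborel K) = \<infinity>"
        using nn_integral_count_space_nat[of "\<lambda>_. emeasure lborel K"]
        by (simp add: ennreal_mult_top)
      with fin show False by simp
    qed
    thus ?thesis using K by (auto simp: K_def null_sets_def)
  qed
  have "S = (\<Union>R::nat. S \<inter> cball 0 (real R))"
    by (auto simp: real_arch_simple)
  also have "\<dots> \<in> null_sets lborel" by (intro null_sets_UN piece)
  finally show ?thesis .
qed

text \<open>The directions \<open>e\<close> and \<open>e'\<close> are parameters rather than existentially quantified, so that the set is
  closed; countably many parameters will suffice by density.\<close>

definition nearly_affine_along :: "('a::real_normed_vector \<Rightarrow> 'b::real_normed_vector) \<Rightarrow> real \<Rightarrow> real \<Rightarrow> 'a \<Rightarrow> 'b \<Rightarrow> 'a set" where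
  "nearly_affine_along u \<epsilon> r e e' =
     (\<Inter>t\<in>{0..r}. {x. norm (u (x + t *\<^sub>R e) - u x - t *\<^sub>R e') \<le> \<epsilon> * t})"

lemma closed_nearly_affine_along:
  assumes "continuous_on UNIV u"
  shows "closed (nearly_affine_along u \<epsilon> r e e')"
  unfolding nearly_affine_along_def
  by (intro closed_INT ballI closed_Collect_le continuous_intros continuous_on_compose2[OF assms]) auto

text \<open>Suppose that \<open>x\<close> and \<open>y = x - t *\<^sub>R f\<close> both belong to the set. Then \<open>u\<close> moves by about \<open>t *\<^sub>R f'\<close> from
  \<open>y\<close> to \<open>x\<close> and by about \<open>t *\<^sub>R e'\<close> from \<open>x\<close> to \<open>x + t *\<^sub>R e\<close>. By the gap it would stretch the distance
  \<open>t * norm (e + f)\<close> from \<open>y\<close> to \<open>x + t *\<^sub>R e\<close>. Hence the set misses its short translates along \<open>f\<close>.\<close>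

lemma nearly_affine_null:
  fixes u :: "'a::euclidean_space \<Rightarrow> 'b::euclidean_space"
  assumes u: "1-lipschitz_on UNIV u" and r: "r > 0"
    and gap: "norm (e' + f') > norm (e + f) + 2 * \<epsilon>"
  shows "nearly_affine_along u \<epsilon> r e e' \<inter> nearly_affine_along u \<epsilon> r f f' \<in> null_sets lborel"
proof (rule null_set_if_disjoint_translates[OF _ r])
  show "closed (nearly_affine_along u \<epsilon> r e e' \<inter> nearly_affine_along u \<epsilon> r f f')"
    by (intro closed_Int closed_nearly_affine_along lipschitz_on_continuous_on[OF u])
  fix y t assume y: "y \<in> nearly_affine_along u \<epsilon> r e e' \<inter> nearly_affine_along u \<epsilon> r f f'"
    and t: "0 < t" "t \<le> r"
  show "y + t *\<^sub>R f \<notin> nearly_affine_along u \<epsilon> r e e' \<inter> nearly_affine_along u \<epsilon> r f f'"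
  proof
    define x where "x = y + t *\<^sub>R f"
    assume "y + t *\<^sub>R f \<in> nearly_affine_along u \<epsilon> r e e' \<inter> nearly_affine_along u \<epsilon> r f f'"
    hence x: "norm (u (x + t *\<^sub>R e) - u x - t *\<^sub>R e') \<le> \<epsilon> * t"
      using t by (auto simp: x_def nearly_affine_along_def)
    have y': "norm (u x - u y - t *\<^sub>R f') \<le> \<epsilon> * t"
      using y t by (auto simp: x_def nearly_affine_along_def)
    have "t * norm (e' + f') = norm (t *\<^sub>R (e' + f'))" using t by simp
    also have "t *\<^sub>R (e' + f') = (u (x + t *\<^sub>R e) - u y)
        - (u (x + t *\<^sub>R e) - u x - t *\<^sub>R e') - (u x - u y - t *\<^sub>R f')"
      by (simp add: algebra_simps)
    also have "norm \<dots> \<le> norm (u (x + t *\<^sub>R e) - u y) + \<epsilon> * t + \<epsilon> * t"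
    proof -
      have "norm (p - q - s) \<le> norm p + norm q + norm s" for p q s :: 'b
        using norm_triangle_ineq4[of "p - q" s] norm_triangle_ineq4[of p q] by linarith
      from this[of "u (x + t *\<^sub>R e) - u y" "u (x + t *\<^sub>R e) - u x - t *\<^sub>R e'" "u x - u y - t *\<^sub>R f'"]
      show ?thesis using x y' by linarith
    qed
    also have "norm (u (x + t *\<^sub>R e) - u y) \<le> norm (x + t *\<^sub>R e - y)"
      using lipschitz_onD[OF u, of "x + t *\<^sub>R e" y] by (simp add: dist_norm)
    also have "x + t *\<^sub>R e - y = t *\<^sub>R (e + f)" by (simp add: x_def algebra_simps)
    also have "norm (t *\<^sub>R (e + f)) = t * norm (e + f)" using t by simp
    also have "t * norm (e + f) + \<epsilon> * t + \<epsilon> * t = t * (norm (e + f) + 2 * \<epsilon>)"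
      by (simp add: algebra_simps)
    finally have "norm (e' + f') \<le> norm (e + f) + 2 * \<epsilon>" using t by simp
    thus False using gap by simp
  qed
qed

text \<open>A point at distance \<open>t\<close> from \<open>x\<close> on the segment has distance \<open>d - t\<close> from \<open>y\<close>. Its image is at most as far
  from \<open>u x\<close> and \<open>u y\<close>, which are \<open>d\<close> apart, so this is the equality case of the triangle inequality.\<close>

lemma isometric_segment:
  fixes u :: "'a::euclidean_space \<Rightarrow> 'b::euclidean_space"
  assumes u: "1-lipschitz_on UNIV u" and iso: "norm (u y - u x) = norm (y - x)"
    and d: "d = norm (y - x)" "d > 0" and t: "0 \<le> t" "t \<le> d"
  shows "u (x + t *\<^sub>R ((1 / d) *\<^sub>R (y - x))) = u x + t *\<^sub>R ((1 / d) *\<^sub>R (u y - u x))"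
proof -
  define p where "p = x + t *\<^sub>R ((1 / d) *\<^sub>R (y - x))"
  define a where "a = u p - u x"
  define b where "b = u y - u p"
  have lip: "norm (u w - u z) \<le> norm (w - z)" for w z
    using lipschitz_onD[OF u, of w z] by (simp add: dist_norm)
  have "norm (p - x) = t" using d t by (simp add: p_def)
  hence na: "norm a \<le> t" using lip[of p x] by (simp add: a_def)
  have "y - p = (1 - t / d) *\<^sub>R (y - x)" by (simp add: p_def algebra_simps)
  hence "norm (y - p) = (1 - t / d) * d" using d t by simp
  hence "norm (y - p) = d - t" using d by (simp add: field_simps)
  hence nb: "norm b \<le> d - t" using lip[of y p] by (simp add: b_def)
  have ab: "a + b = u y - u x" by (simp add: a_def b_def)
  have nab: "norm (a + b) = d" unfolding ab using iso d by simp
  have a2: "a \<bullet> a \<le> t\<^sup>2" using power_mono[OF na, of 2] by (simp add: power2_norm_eq_inner)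
  have b2: "b \<bullet> b \<le> (d - t)\<^sup>2" using power_mono[OF nb, of 2] by (simp add: power2_norm_eq_inner)
  have s2: "a \<bullet> a + 2 * (a \<bullet> b) + b \<bullet> b = d\<^sup>2"
    using nab power2_norm_eq_inner[of "a + b"] by (simp add: inner_add_left inner_add_right inner_commute)
  have expand: "(norm (d *\<^sub>R a - t *\<^sub>R w))\<^sup>2 = d\<^sup>2 * (a \<bullet> a) - 2 * d * t * (a \<bullet> w) + t\<^sup>2 * (w \<bullet> w)" for w
    unfolding power2_norm_eq_inner
    by (simp add: inner_diff_left inner_diff_right inner_commute[of w a] algebra_simps power2_eq_square)
  have "(a + b) \<bullet> (a + b) = d\<^sup>2" using nab power2_norm_eq_inner[of "a + b"] by simp
  hence "(norm (d *\<^sub>R a - t *\<^sub>R (a + b)))\<^sup>2 = d\<^sup>2 * (a \<bullet> a) - d * t * (2 * (a \<bullet> a + a \<bullet> b)) + t\<^sup>2 * d\<^sup>2"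
    unfolding expand by (simp add: inner_add_right)
  also have "2 * (a \<bullet> a + a \<bullet> b) = a \<bullet> a + d\<^sup>2 - b \<bullet> b" using s2 by simp
  also have "d\<^sup>2 * (a \<bullet> a) - d * t * (a \<bullet> a + d\<^sup>2 - b \<bullet> b) + t\<^sup>2 * d\<^sup>2
      = d * (d - t) * (a \<bullet> a) + d * t * (b \<bullet> b) - d * t * d\<^sup>2 + t\<^sup>2 * d\<^sup>2"
    by (simp add: algebra_simps power2_eq_square)
  also have "\<dots> \<le> d * (d - t) * t\<^sup>2 + d * t * (d - t)\<^sup>2 - d * t * d\<^sup>2 + t\<^sup>2 * d\<^sup>2"
    using a2 b2 d t by (intro add_mono diff_mono mult_left_mono) auto
  also have "\<dots> = 0" by (simp add: algebra_simps power2_eq_square)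
  finally have "d *\<^sub>R a = t *\<^sub>R (a + b)" by simp
  hence "(1 / d) *\<^sub>R (d *\<^sub>R a) = (1 / d) *\<^sub>R (t *\<^sub>R (a + b))" by simp
  hence "a = t *\<^sub>R ((1 / d) *\<^sub>R (a + b))" using d by (simp add: mult.commute)
  thus ?thesis unfolding ab by (simp add: a_def p_def algebra_simps)
qed

lemma countable_dense_approx:
  "\<exists>D :: 'a::euclidean_space set. countable D \<and> (\<forall>x. \<forall>e>0. \<exists>d\<in>D. norm (d - x) < e)"
proof -
  obtain D :: "'a set" where D: "countable D" "\<And>X. open X \<Longrightarrow> X \<noteq> {} \<Longrightarrow> \<exists>d\<in>D. d \<in> X"
    by (erule countable_dense_setE)
  have "\<exists>d\<in>D. norm (d - x) < e" if "e > 0" for x e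
    using D(2)[of "ball x e"] that by (auto simp: dist_norm norm_minus_commute)
  thus ?thesis using D(1) by blast
qed

lemma nearly_affine_approx:
  fixes u :: "'a::euclidean_space \<Rightarrow> 'b::euclidean_space"
  assumes u: "1-lipschitz_on UNIV u"
    and aff: "\<And>t. 0 \<le> t \<Longrightarrow> t \<le> d \<Longrightarrow> u (x + t *\<^sub>R e) = u x + t *\<^sub>R e'"
    and app: "norm (g - e) \<le> \<eta>" "norm (g' - e') \<le> \<eta>" and r: "r \<le> d"
  shows "x \<in> nearly_affine_along u (2 * \<eta>) r g g'"
  unfolding nearly_affine_along_def
proof (intro INT_I CollectI)
  fix t assume t: "t \<in> {0..r}"
  have "u (x + t *\<^sub>R g) - u x - t *\<^sub>R g' = (u (x + t *\<^sub>R g) - u (x + t *\<^sub>R e)) - t *\<^sub>R (g' - e')"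
    using aff[of t] t r by (simp add: algebra_simps)
  also have "norm \<dots> \<le> norm (u (x + t *\<^sub>R g) - u (x + t *\<^sub>R e)) + norm (t *\<^sub>R (g' - e'))"
    by (rule norm_triangle_ineq4)
  also have "\<dots> \<le> t * \<eta> + t * \<eta>"
  proof (rule add_mono)
    have "norm (u (x + t *\<^sub>R g) - u (x + t *\<^sub>R e)) \<le> norm ((x + t *\<^sub>R g) - (x + t *\<^sub>R e))"
      using lipschitz_onD[OF u, of "x + t *\<^sub>R g" "x + t *\<^sub>R e"] by (simp add: dist_norm)
    also have "(x + t *\<^sub>R g) - (x + t *\<^sub>R e) = t *\<^sub>R (g - e)" by (simp add: algebra_simps)
    also have "norm \<dots> \<le> t * \<eta>" using t app(1) by (simp add: mult_left_mono)
    finally show "norm (u (x + t *\<^sub>R g) - u (x + t *\<^sub>R e)) \<le> t * \<eta>" .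
    show "norm (t *\<^sub>R (g' - e')) \<le> t * \<eta>" using t app(2) by (simp add: mult_left_mono)
  qed
  finally show "norm (u (x + t *\<^sub>R g) - u x - t *\<^sub>R g') \<le> 2 * \<eta> * t" by (simp add: algebra_simps)
qed

text \<open>Let \<open>u\<close> preserve the distances from \<open>x\<close> to \<open>y\<close> and to \<open>z\<close>, but not that from \<open>y\<close> to \<open>z\<close>. Then \<open>u\<close> is affine
  on both segments and strictly decreases the angle between their unit directions \<open>e\<close> and \<open>f\<close>, that is,
  \<open>norm (e + f)\<close> is less than \<open>norm (e' + f')\<close> for the images of the directions. This gap persists after
  replacing the four directions by nearby elements of countable dense sets, so \<open>x\<close> belongs to one of
  countably many null sets.\<close>

lemma isometric_branching_null:
  fixes u :: "'a::euclidean_space \<Rightarrow> 'b::euclidean_space"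
  assumes u: "1-lipschitz_on UNIV u"
  shows "\<exists>N\<in>null_sets lborel. \<forall>x y z. x \<notin> N \<longrightarrow> norm (u x - u y) = norm (x - y) \<longrightarrow>
    norm (u x - u z) = norm (x - z) \<longrightarrow> norm (u y - u z) = norm (y - z)"
proof -
  obtain D :: "'a set" where D: "countable D" "\<forall>x. \<forall>e>0. \<exists>d\<in>D. norm (d - x) < e"
    using countable_dense_approx[where 'a='a] by blast
  obtain D' :: "'b set" where D': "countable D'" "\<forall>x. \<forall>e>0. \<exists>d\<in>D'. norm (d - x) < e"
    using countable_dense_approx[where 'a='b] by blast
  define bad where "bad = (\<lambda>(e, e', f, f', k, j). if norm (e' + f') > norm (e + f) + 4 / Suc k
    then nearly_affine_along u (2 / Suc k) (1 / Suc j) e e' \<inter> nearly_affine_along u (2 / Suc k) (1 / Suc j) f f'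
    else {})"
  define I where "I = D \<times> D' \<times> D \<times> D' \<times> (UNIV :: nat set) \<times> (UNIV :: nat set)"
  have "countable I" unfolding I_def using D(1) D'(1) by auto
  moreover have "bad i \<in> null_sets lborel" for i
  proof -
    obtain e e' f f' k j where i: "i = (e, e', f, f', k, j)" by (cases i)
    show ?thesis unfolding i bad_def by (auto intro!: nearly_affine_null[OF u])
  qed
  ultimately have N: "(\<Union>i\<in>I. bad i) \<in> null_sets lborel" by (intro null_sets_UN') auto
  moreover have "norm (u y - u z) = norm (y - z)"
    if x: "x \<notin> (\<Union>i\<in>I. bad i)" and xy: "norm (u x - u y) = norm (x - y)" and xz: "norm (u x - u z) = norm (x - z)" for x y z
  proof (rule ccontr)
    assume "norm (u y - u z) \<noteq> norm (y - z)"
    hence less: "norm (u y - u z) < norm (y - z)"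
      using lipschitz_onD[OF u, of y z] by (simp add: dist_norm)
    hence ne: "y \<noteq> x" "z \<noteq> x" using xy xz by (auto simp: norm_minus_commute)
    define d1 where "d1 = norm (y - x)"
    define d2 where "d2 = norm (z - x)"
    define e where "e = (1 / d1) *\<^sub>R (y - x)"
    define e' where "e' = (1 / d1) *\<^sub>R (u y - u x)"
    define f where "f = (1 / d2) *\<^sub>R (z - x)"
    define f' where "f' = (1 / d2) *\<^sub>R (u z - u x)"
    have d: "d1 > 0" "d2 > 0" using ne by (auto simp: d1_def d2_def)
    have ud: "norm (u y - u x) = d1" "norm (u z - u x) = d2"
      using xy xz by (simp_all add: d1_def d2_def norm_minus_commute)
    have unit: "norm e = 1" "norm e' = 1" "norm f = 1" "norm f' = 1"
      using d ud by (simp_all add: e_def e'_def f_def f'_def d1_def d2_def)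
    have ye: "y - x = d1 *\<^sub>R e" "z - x = d2 *\<^sub>R f" "u y - u x = d1 *\<^sub>R e'" "u z - u x = d2 *\<^sub>R f'"
      using d by (simp_all add: e_def e'_def f_def f'_def)
    have "y - z = d1 *\<^sub>R e - d2 *\<^sub>R f" "u y - u z = d1 *\<^sub>R e' - d2 *\<^sub>R f'"
      using ye by (simp_all add: algebra_simps)
    hence "(norm (d1 *\<^sub>R e' - d2 *\<^sub>R f'))\<^sup>2 < (norm (d1 *\<^sub>R e - d2 *\<^sub>R f))\<^sup>2"
      using power_strict_mono[OF less, of 2] by simp
    hence "d1 * d2 * (e \<bullet> f) < d1 * d2 * (e' \<bullet> f')"
      using unit unfolding norm_eq_1
      by (simp add: power2_norm_eq_inner inner_diff_left inner_diff_right inner_commute algebra_simps)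
    hence "e \<bullet> f < e' \<bullet> f'" using d by simp
    hence "(norm (e + f))\<^sup>2 < (norm (e' + f'))\<^sup>2"
      using unit unfolding norm_eq_1
      by (simp add: power2_norm_eq_inner inner_add_left inner_add_right inner_commute)
    hence "norm (e + f) < norm (e' + f')" by (rule power2_less_imp_less) simp
    \<comment> \<open>approximating both directions and both images within \<open>\<eta>\<close> consumes \<open>4 * \<eta>\<close> of the gap, and the
    tolerance \<open>2 * \<eta>\<close> of the nearly affine sets another \<open>4 * \<eta>\<close>\<close>
    then obtain k where k: "inverse (real (Suc k)) < (norm (e' + f') - norm (e + f)) / 8"
      using reals_Archimedean[of "(norm (e' + f') - norm (e + f)) / 8"] by auto
    define \<eta> where "\<eta> = 1 / real (Suc k)"
    have \<eta>: "\<eta> > 0" "8 * \<eta> < norm (e' + f') - norm (e + f)"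
      using k by (simp_all add: \<eta>_def inverse_eq_divide)
    obtain j where j: "inverse (real (Suc j)) < min d1 d2"
      using reals_Archimedean[of "min d1 d2"] d by auto
    obtain g h where g: "g \<in> D" "norm (g - e) < \<eta>" and h: "h \<in> D" "norm (h - f) < \<eta>"
      using D(2)[rule_format, OF \<eta>(1)] by meson
    obtain g' h' where g': "g' \<in> D'" "norm (g' - e') < \<eta>" and h': "h' \<in> D'" "norm (h' - f') < \<eta>"
      using D'(2)[rule_format, OF \<eta>(1)] by meson
    have x1: "x \<in> nearly_affine_along u (2 * \<eta>) (1 / Suc j) g g'"
    proof (rule nearly_affine_approx[OF u, of d1])
      show "u (x + t *\<^sub>R e) = u x + t *\<^sub>R e'" if "0 \<le> t" "t \<le> d1" for t
        unfolding e_def e'_def using ud(1) d(1) that by (intro isometric_segment[OF u]) (auto simp: d1_def)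
    qed (use g g' j in \<open>auto simp: inverse_eq_divide\<close>)
    have x2: "x \<in> nearly_affine_along u (2 * \<eta>) (1 / Suc j) h h'"
    proof (rule nearly_affine_approx[OF u, of d2])
      show "u (x + t *\<^sub>R f) = u x + t *\<^sub>R f'" if "0 \<le> t" "t \<le> d2" for t
        unfolding f_def f'_def using ud(2) d(2) that by (intro isometric_segment[OF u]) (auto simp: d2_def)
    qed (use h h' j in \<open>auto simp: inverse_eq_divide\<close>)
    have "norm (g + h) \<le> norm (e + f) + 2 * \<eta>"
      using norm_triangle_ineq[of "e + f" "(g - e) + (h - f)"] norm_triangle_ineq[of "g - e" "h - f"] g(2) h(2)
      by (simp add: algebra_simps)
    moreover have "norm (e' + f') \<le> norm (g' + h') + 2 * \<eta>"
      using norm_triangle_ineq4[of "g' + h'" "(g' - e') + (h' - f')"] norm_triangle_ineq[of "g' - e'" "h' - f'"] g'(2) h'(2)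
      by (simp add: algebra_simps)
    ultimately have gap: "norm (g' + h') > norm (g + h) + 4 * \<eta>" using \<eta>(2) by linarith
    have "x \<in> bad (g, g', h, h', k, j)"
      using x1 x2 gap by (simp add: bad_def \<eta>_def)
    thus False using x g h g' h' by (auto simp: I_def)
  qed
  ultimately show ?thesis by blast
qed

text \<open>All points at preserved distance from \<open>x\<close> form an isometric set, and it contains every other one that
  contains \<open>x\<close>.\<close>

lemma unique_leaf:
  fixes u :: "real ^ 'n \<Rightarrow> real ^ 'm"
  assumes u: "\<And>y z. norm (u x - u y) = norm (x - y) \<Longrightarrow> norm (u x - u z) = norm (x - z) \<Longrightarrow> norm (u y - u z) = norm (y - z)"
  shows "\<exists>!S. leaf u S \<and> x \<in> S"
proof (rule ex1I)
  let ?L = "{y. norm (u x - u y) = norm (x - y)}"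
  have iso: "isometric_on ?L u" unfolding isometric_on_def using u by blast
  have sub: "T \<subseteq> ?L" if "isometric_on T u" "x \<in> T" for T
    using that by (auto simp: isometric_on_def)
  have xL: "x \<in> ?L" by simp
  show "leaf u ?L \<and> x \<in> ?L"
    unfolding leaf_def using iso sub xL by blast
  fix S assume "leaf u S \<and> x \<in> S"
  thus "S = ?L" using sub[of S] iso unfolding leaf_def by blast
qed

section \<open>Restriction to transport sets\<close>

lemma vector_measure_restriction:
  assumes \<nu>: "vector_measure \<nu>" and A: "A \<in> sets borel"
  shows "vector_measure (measure_restriction \<nu> A)"
  unfolding vector_measure_def measure_restriction_def
proof (intro allI impI)
  fix E :: "nat \<Rightarrow> 'a set" assume E: "range E \<subseteq> sets borel" "disjoint_family E"
  have "range (\<lambda>i. E i \<inter> A) \<subseteq> sets borel" using E(1) A by (auto simp: image_subset_iff)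
  moreover have "disjoint_family (\<lambda>i. E i \<inter> A)"
    by (rule disjoint_family_on_bisimulation[OF E(2)]) auto
  ultimately have "(\<lambda>i. \<nu> (E i \<inter> A)) sums \<nu> (\<Union>i. E i \<inter> A)" by (rule vector_measure_sums[OF \<nu>])
  thus "(\<lambda>i. \<nu> (E i \<inter> A)) sums \<nu> ((\<Union>i. E i) \<inter> A)" by simp
qed

lemma vector_density_restriction:
  assumes M: "vector_density \<nu> M h" and A: "A \<in> sets borel"
  shows "vector_density (measure_restriction \<nu> A) M (\<lambda>x. indicat_real A x *\<^sub>R h x)"
  unfolding vector_density_def
proof (intro conjI ballI)
  note M' = vector_densityD[OF M]
  show "sets M = sets borel" by (rule M'(1))
  show "integrable M (\<lambda>x. indicat_real A x *\<^sub>R h x)"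
    using A M'(1,2) by (intro integrable_mult_indicator) auto
  fix B :: "'a set" assume B: "B \<in> sets borel"
  have "measure_restriction \<nu> A B = (LINT x:B \<inter> A|M. h x)"
    unfolding measure_restriction_def using A B by (intro M'(3)) auto
  also have "\<dots> = (LINT x:B|M. indicat_real A x *\<^sub>R h x)"
    unfolding set_lebesgue_integral_def
    by (intro Bochner_Integration.integral_cong) (auto simp: indicator_def)
  finally show "measure_restriction \<nu> A B = (LINT x:B|M. indicat_real A x *\<^sub>R h x)" .
qed

lemma AE_marginal_null:
  assumes sP: "sets P = sets borel" and ac: "absolutely_continuous lborel (distr P borel g)"
    and g: "g \<in> measurable P borel" and N: "N \<in> null_sets lborel"
  shows "AE z in P. g z \<notin> N"
proof -
  have "N \<in> null_sets (distr P borel g)" using ac N by (auto simp: absolutely_continuous_def)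
  hence "AE y in distr P borel g. y \<notin> N" by (rule AE_not_in)
  thus ?thesis by (rule AE_distrD[OF g])
qed

lemma wasserstein_integrable:
  fixes \<mu> :: "(real ^ 'n) set \<Rightarrow> real ^ 'm" and v :: "real ^ 'n \<Rightarrow> 'c::euclidean_space"
  assumes \<mu>: "\<mu> \<in> wasserstein_space" and h: "vector_density \<mu> (total_variation \<mu>) h" "\<forall>x. norm (h x) \<le> 1"
    and v: "1-lipschitz_on UNIV v"
  shows "integrable (total_variation \<mu>) (\<lambda>x. norm (v x) * norm (h x))"
proof (rule Bochner_Integration.integrable_bound[OF wasserstein_moment[OF \<mu> v]])
  have "v \<in> borel_measurable (total_variation \<mu>)"
    using lipschitz_borel_measurable[OF v] measurable_cong_sets[OF sets_total_variation[of \<mu>] refl] by blast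
  thus "(\<lambda>x. norm (v x) * norm (h x)) \<in> borel_measurable (total_variation \<mu>)"
    using vector_densityD(5)[OF h(1)] by simp
  show "AE x in total_variation \<mu>. norm (norm (v x) * norm (h x)) \<le> norm (norm (v x))"
    using h(2) by (intro AE_I2) (simp add: abs_mult mult_left_le)
qed

text \<open>Absence of a duality gap: the optimal potential dominates the maps from the duality theorem.\<close>

lemma optimal_pairing:
  fixes \<mu> :: "(real ^ 'n) set \<Rightarrow> real ^ 'm"
  assumes \<mu>: "\<mu> \<in> wasserstein_space" and u: "optimal_potential \<mu> u" and \<pi>: "optimal_transport \<mu> \<pi>"
    and h: "vector_density \<mu> (total_variation \<mu>) h" "\<forall>x. norm (h x) \<le> 1"
  shows "transport_cost \<pi> = ennreal (\<integral>x. u x \<bullet> h x \<partial>total_variation \<mu>)"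
proof (rule antisym)
  let ?M = "total_variation \<mu>"
  note M' = vector_densityD[OF h(1)]
  have lip: "1-lipschitz_on UNIV u" using u by (simp add: optimal_potential_def)
  note int = wasserstein_integrable[OF \<mu> h]
  have vi: "vector_integral \<mu> v = (\<integral>x. v x \<bullet> h x \<partial>?M)" if v: "1-lipschitz_on UNIV v" for v
    by (rule vector_integral_density[OF h(1) lipschitz_borel_measurable[OF v] int[OF v]])
  have opt: "(\<integral>x. v x \<bullet> h x \<partial>?M) \<le> (\<integral>x. u x \<bullet> h x \<partial>?M)" if v: "1-lipschitz_on UNIV v" for v
  proof -
    have "ereal (vector_integral \<mu> v) \<le> ereal (vector_integral \<mu> u)"
      using u v unfolding optimal_potential_def by (auto intro: SUP_upper)
    thus ?thesis by (simp add: vi[OF v] vi[OF lip])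
  qed
  have \<pi>t: "\<pi> \<in> transports \<mu>" and W: "transport_cost \<pi> = wasserstein_norm \<mu>"
    using \<pi> by (auto simp: optimal_transport_def)
  show "ennreal (\<integral>x. u x \<bullet> h x \<partial>?M) \<le> transport_cost \<pi>"
    by (rule pairing_le_cost[OF h(1) \<pi>t lip int[OF lip]])
  show "transport_cost \<pi> \<le> ennreal (\<integral>x. u x \<bullet> h x \<partial>?M)"
  proof (rule ennreal_le_epsilon)
    fix e :: real assume e: "e > 0"
    obtain v where v: "1-lipschitz_on UNIV v" and le: "wasserstein_norm \<mu> \<le> ennreal ((\<integral>x. v x \<bullet> h x \<partial>?M) + e)"
      using wasserstein_duality[OF \<mu> h(1) h(2)[rule_format] e] by blast
    have "transport_cost \<pi> \<le> ennreal ((\<integral>x. v x \<bullet> h x \<partial>?M) + e)" using W le by simp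
    also have "\<dots> \<le> ennreal ((\<integral>x. u x \<bullet> h x \<partial>?M) + e)" using opt[OF v] by (intro ennreal_leI) simp
    also have "\<dots> \<le> ennreal (\<integral>x. u x \<bullet> h x \<partial>?M) + ennreal e"
      using e by (cases "(\<integral>x. u x \<bullet> h x \<partial>?M) \<ge> 0") (simp_all add: ennreal_leI ennreal_neg)
    finally show "transport_cost \<pi> \<le> ennreal (\<integral>x. u x \<bullet> h x \<partial>?M) + ennreal e" .
  qed
qed

theorem theorem4:
  fixes \<mu> :: "(real ^ 'n) set \<Rightarrow> real ^ 'm"
    and u :: "real ^ 'n \<Rightarrow> real ^ 'm"
    and \<pi> :: "((real ^ 'n) \<times> (real ^ 'n)) set \<Rightarrow> real ^ 'm"
    and A :: "(real ^ 'n) set"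
  assumes "\<mu> \<in> wasserstein_space"
    and "optimal_potential \<mu> u"
    and "optimal_transport \<mu> \<pi>"
    and "absolutely_continuous lborel (distr (total_variation \<pi>) borel fst)"
    and "absolutely_continuous lborel (distr (total_variation \<pi>) borel snd)"
    and "transport_set u A"
  shows "\<mu> A = 0 \<and>
    (measure_restriction \<pi> (A \<times> A) \<in> transports (measure_restriction \<mu> A) \<and>
     optimal_transport (measure_restriction \<mu> A) (measure_restriction \<pi> (A \<times> A))) \<and>
    optimal_potential (measure_restriction \<mu> A) u"
proof -
  let ?M = "total_variation \<mu>" and ?P = "total_variation \<pi>"
  let ?\<mu>A = "measure_restriction \<mu> A" and ?\<pi>A = "measure_restriction \<pi> (A \<times> A)"
  have lip: "1-lipschitz_on UNIV u" using assms(2) by (simp add: optimal_potential_def)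
  have A: "A \<in> sets borel"
    and transport: "\<And>x y. x \<in> A \<Longrightarrow> \<exists>!S. leaf u S \<and> x \<in> S \<Longrightarrow> norm (u x - u y) = norm (x - y) \<Longrightarrow> y \<in> A"
    using assms(6) unfolding transport_set_def by blast+
  have \<mu>v: "vector_measure \<mu>" using assms(1) by (simp add: wasserstein_space_def)
  have \<pi>v: "vector_measure \<pi>" and marg: "\<forall>B\<in>sets borel. marginal1 \<pi> B - marginal2 \<pi> B = \<mu> B"
    using assms(3) by (auto simp: optimal_transport_def transports_def)
  obtain h where h: "\<forall>x. norm (h x) \<le> 1" "vector_density \<mu> ?M h"
    using total_variation_density[OF \<mu>v] by blast
  obtain k where k: "\<forall>z. norm (k z) \<le> 1" "vector_density \<pi> ?P k"
    using total_variation_density[OF \<pi>v] by blast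
  note M' = vector_densityD[OF h(2)] and P' = vector_densityD[OF k(2)]
  have kb: "norm (k z) \<le> 1" and hb: "norm (h x) \<le> 1" for z x using k(1) h(1) by blast+
  note fs [measurable] = measurable_fst_snd_borel[OF sets_total_variation[of \<pi>]]
  have km [measurable]: "k \<in> borel_measurable ?P" by (rule P'(5))
  have ub: "u \<in> borel_measurable borel" by (rule lipschitz_borel_measurable[OF lip])
  have [measurable]: "(\<lambda>z. u (fst z)) \<in> borel_measurable ?P" "(\<lambda>z. u (snd z)) \<in> borel_measurable ?P"
    by (intro measurable_compose[OF _ ub] fs)+
  have cost: "transport_cost \<pi> = ennreal (\<integral>x. u x \<bullet> h x \<partial>?M)"
    by (rule optimal_pairing[OF assms(1-3) h(2,1)])
  define c where "c z = norm (fst z - snd z)" for z :: "(real ^ 'n) \<times> (real ^ 'n)"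
  define g where "g z = (u (fst z) - u (snd z)) \<bullet> k z" for z
  have [measurable]: "c \<in> borel_measurable ?P" "g \<in> borel_measurable ?P"
    unfolding c_def[abs_def] g_def[abs_def] by measurable
  have ulip: "norm (u x - u y) \<le> norm (x - y)" for x y
    using lipschitz_onD[OF lip, of x y] by (simp add: dist_norm)
  have intc: "integrable ?P c"
  proof (rule integrableI_nonneg)
    show "(\<integral>\<^sup>+z. ennreal (c z) \<partial>?P) < \<infinity>"
      using cost unfolding transport_cost_def c_def by simp
  qed (simp_all add: c_def)
  have g_le: "norm (g z) \<le> norm (u (fst z) - u (snd z))" for z
  proof -
    have "norm (g z) \<le> norm (u (fst z) - u (snd z)) * norm (k z)"
      unfolding g_def by (simp add: Cauchy_Schwarz_ineq2)
    also have "\<dots> \<le> norm (u (fst z) - u (snd z)) * 1" by (intro mult_left_mono kb) simp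
    finally show ?thesis by simp
  qed
  have g_le_c: "norm (g z) \<le> c z" for z
    using g_le[of z] ulip[of "fst z" "snd z"] by (simp add: c_def)
  have intg: "integrable ?P g"
    by (rule Bochner_Integration.integrable_bound[OF intc]) (use g_le_c in \<open>auto simp: c_def\<close>)
  have intk: "integrable ?P (\<lambda>z. norm (fst z - snd z) * norm (k z))"
  proof (rule Bochner_Integration.integrable_bound[OF intc])
    show "AE z in ?P. norm (norm (fst z - snd z) * norm (k z)) \<le> norm (c z)"
      using kb by (intro AE_I2) (simp add: c_def abs_mult mult_left_le)
  qed measurable
  note intM = wasserstein_integrable[OF assms(1) h(2,1)]
  \<comment> \<open>no duality gap means equality almost everywhere in \<open>g \<le> c\<close>\<close>
  have "(\<integral>x. u x \<bullet> h x \<partial>?M) = (\<integral>z. g z \<partial>?P)"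
    unfolding g_def by (rule pairing_lipschitz[OF h(2) k(2) marg lip intM[OF lip] intk])
  moreover have "transport_cost \<pi> = ennreal (\<integral>z. c z \<partial>?P)"
    unfolding transport_cost_def c_def[symmetric]
    by (rule nn_integral_eq_integral[OF intc]) (simp add: c_def)
  moreover have "0 \<le> (\<integral>z. c z \<partial>?P)" by (simp add: c_def)
  moreover have "(\<integral>z. - c z \<partial>?P) \<le> (\<integral>z. g z \<partial>?P)"
  proof (rule integral_mono)
    show "- c z \<le> g z" for z using g_le_c[of z] by simp
  qed (use intc intg in auto)
  hence "- (\<integral>z. c z \<partial>?P) \<le> (\<integral>z. g z \<partial>?P)" by simp
  ultimately have "(\<integral>z. c z \<partial>?P) \<le> (\<integral>z. g z \<partial>?P)"
    using cost by (cases "0 \<le> (\<integral>z. g z \<partial>?P)") (auto simp: ennreal_neg)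
  moreover have "(\<integral>z. c z - g z \<partial>?P) = (\<integral>z. c z \<partial>?P) - (\<integral>z. g z \<partial>?P)"
    using intc intg by simp
  moreover have diff_nonneg: "0 \<le> c z - g z" for z using g_le_c[of z] by simp
  hence "0 \<le> (\<integral>z. c z - g z \<partial>?P)" by (intro integral_nonneg_AE AE_I2)
  ultimately have "(\<integral>z. c z - g z \<partial>?P) = 0" by linarith
  hence "AE z in ?P. c z - g z = 0"
    using integral_nonneg_eq_0_iff_AE[of ?P "\<lambda>z. c z - g z"] intc intg diff_nonneg by simp
  hence c_g: "AE z in ?P. c z = g z" by eventually_elim simp
  \<comment> \<open>hence almost every pair has preserved distance; both of its ends lie on a single leaf\<close>
  obtain N where N: "N \<in> null_sets lborel"
    and branch: "\<forall>x y z. x \<notin> N \<longrightarrow> norm (u x - u y) = norm (x - y) \<longrightarrow>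
      norm (u x - u z) = norm (x - z) \<longrightarrow> norm (u y - u z) = norm (y - z)"
    using isometric_branching_null[OF lip] by blast
  have stay: "y \<in> A" if "x \<in> A" "x \<notin> N" "norm (u x - u y) = norm (x - y)" for x y
    using that branch by (intro transport[of x y] unique_leaf) auto
  have same: "AE z in ?P. fst z \<in> A \<longleftrightarrow> snd z \<in> A"
    using c_g AE_marginal_null[OF sets_total_variation assms(4) fs(1) N]
      AE_marginal_null[OF sets_total_variation assms(5) fs(2) N]
  proof eventually_elim
    case (elim z)
    have iso: "norm (u (fst z) - u (snd z)) = norm (fst z - snd z)"
      using g_le[of z] ulip[of "fst z" "snd z"] elim(1) by (simp add: c_def)
    hence iso': "norm (u (snd z) - u (fst z)) = norm (snd z - fst z)" by (simp add: norm_minus_commute)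
    show ?case using stay[OF _ elim(2) iso] stay[OF _ elim(3) iso'] by blast
  qed
  have \<pi>_cong: "\<pi> C = \<pi> C'" if C: "C \<in> sets borel" "C' \<in> sets borel"
      and eq: "\<And>z. (fst z \<in> A \<longleftrightarrow> snd z \<in> A) \<Longrightarrow> z \<in> C \<longleftrightarrow> z \<in> C'" for C C'
  proof -
    have "(LINT z:C|?P. k z) = (LINT z:C'|?P. k z)"
      unfolding set_lebesgue_integral_def
    proof (rule integral_cong_AE)
      show "AE z in ?P. indicat_real C z *\<^sub>R k z = indicat_real C' z *\<^sub>R k z"
        using same by eventually_elim (use eq in \<open>simp add: indicator_def\<close>)
    qed (use C in measurable)
    thus ?thesis using C P'(3) by simp
  qed
  have marg_A: "marginal1 ?\<pi>A B - marginal2 ?\<pi>A B = ?\<mu>A B" if B: "B \<in> sets borel" for B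
  proof -
    have BA: "B \<inter> A \<in> sets borel" using B A by auto
    have b: "(X \<times> Y) \<in> sets borel" if "X \<in> sets borel" "Y \<in> sets borel" for X Y :: "(real ^ 'n) set"
      using that by (rule borel_Times)
    have "\<pi> ((B \<times> UNIV) \<inter> (A \<times> A)) = \<pi> ((B \<inter> A) \<times> UNIV)"
      using A B BA by (intro \<pi>_cong sets.Int b) auto
    moreover have "\<pi> ((UNIV \<times> B) \<inter> (A \<times> A)) = \<pi> (UNIV \<times> (B \<inter> A))"
      using A B BA by (intro \<pi>_cong sets.Int b) auto
    ultimately show ?thesis
      using marg[rule_format, OF BA] by (simp only: marginal1_def marginal2_def measure_restriction_def)
  qed
  have AA: "A \<times> A \<in> sets borel" using A by (rule borel_Times[OF _ A])
  have tr: "?\<pi>A \<in> transports ?\<mu>A"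
    unfolding transports_def using marg_A vector_measure_restriction[OF \<pi>v AA] by simp
  have \<mu>A0: "\<mu> A = 0"
    using marg_A[of UNIV] by (simp add: marginal1_def marginal2_def measure_restriction_def)
  \<comment> \<open>the equality \<open>c = g\<close> survives the restriction and closes the duality gap there\<close>
  let ?h = "\<lambda>x. indicat_real A x *\<^sub>R h x" and ?k = "\<lambda>z. indicat_real (A \<times> A) z *\<^sub>R k z"
  have hA: "vector_density ?\<mu>A ?M ?h" by (rule vector_density_restriction[OF h(2) A])
  have kA: "vector_density ?\<pi>A ?P ?k" by (rule vector_density_restriction[OF k(2) AA])
  have intMA: "integrable ?M (\<lambda>x. norm (v x) * norm (?h x))" if v: "1-lipschitz_on UNIV v" for v :: "real ^ 'n \<Rightarrow> real ^ 'm"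
  proof (rule Bochner_Integration.integrable_bound[OF intM[OF v]])
    have "v \<in> borel_measurable ?M"
      using lipschitz_borel_measurable[OF v] measurable_cong_sets[OF sets_total_variation[of \<mu>] refl] by blast
    thus "(\<lambda>x. norm (v x) * norm (?h x)) \<in> borel_measurable ?M"
      using M'(5) A by measurable
    show "AE x in ?M. norm (norm (v x) * norm (?h x)) \<le> norm (norm (v x) * norm (h x))"
      by (intro AE_I2) (simp add: indicator_def)
  qed
  have intPA: "integrable ?P (\<lambda>z. norm (fst z - snd z) * norm (?k z))"
  proof (rule Bochner_Integration.integrable_bound[OF intk])
    show "(\<lambda>z. norm (fst z - snd z) * norm (?k z)) \<in> borel_measurable ?P"
      using AA by measurable
    show "AE z in ?P. norm (norm (fst z - snd z) * norm (?k z)) \<le> norm (norm (fst z - snd z) * norm (k z))"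
      by (intro AE_I2) (simp add: indicator_def)
  qed
  have viA: "vector_integral ?\<mu>A v = (\<integral>x. v x \<bullet> ?h x \<partial>?M)" if v: "1-lipschitz_on UNIV v" for v
    by (rule vector_integral_density[OF hA lipschitz_borel_measurable[OF v] intMA[OF v]])
  have weak: "ennreal (vector_integral ?\<mu>A v) \<le> transport_cost \<rho>"
    if v: "1-lipschitz_on UNIV v" and \<rho>: "\<rho> \<in> transports ?\<mu>A" for v \<rho>
    unfolding viA[OF v] by (rule pairing_le_cost[OF hA \<rho> v intMA[OF v]])
  have indc: "integrable ?P (\<lambda>z. indicat_real (A \<times> A) z * c z)"
    using integrable_mult_indicator[OF _ intc, of "A \<times> A"] AA by simp
  have "vector_integral ?\<mu>A u = (\<integral>z. (u (fst z) - u (snd z)) \<bullet> ?k z \<partial>?P)"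
    unfolding viA[OF lip] using marg_A by (intro pairing_lipschitz[OF hA kA _ lip intMA[OF lip] intPA]) blast
  also have "\<dots> = (\<integral>z. indicat_real (A \<times> A) z * c z \<partial>?P)"
  proof (rule integral_cong_AE)
    show "AE z in ?P. (u (fst z) - u (snd z)) \<bullet> ?k z = indicat_real (A \<times> A) z * c z"
      using c_g by eventually_elim (simp add: g_def)
    show "(\<lambda>z. (u (fst z) - u (snd z)) \<bullet> ?k z) \<in> borel_measurable ?P"
      using AA by measurable
  qed (use indc in simp)
  finally have val: "vector_integral ?\<mu>A u = (\<integral>z. indicat_real (A \<times> A) z * c z \<partial>?P)" .
  hence val_nonneg: "0 \<le> vector_integral ?\<mu>A u" by (simp add: c_def)
  have "transport_cost ?\<pi>A \<le> (\<integral>\<^sup>+z. ennreal (norm (fst z - snd z)) \<partial>density ?P (indicator (A \<times> A)))"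
  proof (rule transport_cost_le[OF vector_measure_restriction[OF \<pi>v AA]])
    fix B :: "((real ^ 'n) \<times> (real ^ 'n)) set" assume B: "B \<in> sets borel"
    have "emeasure (density ?P (indicator (A \<times> A))) B = emeasure ?P (B \<inter> A \<times> A)"
      using AA B by (subst emeasure_density) (auto simp: Int_commute nn_integral_indicator simp flip: indicator_inter_arith)
    thus "ennreal (norm (?\<pi>A B)) \<le> emeasure (density ?P (indicator (A \<times> A))) B"
      using norm_le_total_variation[OF \<pi>v sets.Int[OF B AA]] by (simp add: measure_restriction_def)
  qed simp
  also have "\<dots> = (\<integral>\<^sup>+z. ennreal (indicat_real (A \<times> A) z * c z) \<partial>?P)"
    using AA by (subst nn_integral_density) (auto simp: c_def indicator_def intro!: nn_integral_cong)
  also have "\<dots> = ennreal (vector_integral ?\<mu>A u)"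
    unfolding val by (rule nn_integral_eq_integral[OF indc]) (simp add: c_def)
  finally have cost_A: "transport_cost ?\<pi>A \<le> ennreal (vector_integral ?\<mu>A u)" .
  have "wasserstein_norm ?\<mu>A = transport_cost ?\<pi>A"
    unfolding wasserstein_norm_def
  proof (rule antisym)
    show "(INF \<rho>\<in>transports ?\<mu>A. transport_cost \<rho>) \<le> transport_cost ?\<pi>A" by (rule INF_lower[OF tr])
    show "transport_cost ?\<pi>A \<le> (INF \<rho>\<in>transports ?\<mu>A. transport_cost \<rho>)"
      using order_trans[OF cost_A weak[OF lip]] by (intro INF_greatest)
  qed
  hence opt_tr: "optimal_transport ?\<mu>A ?\<pi>A" using tr by (simp add: optimal_transport_def)
  have max: "vector_integral ?\<mu>A v \<le> vector_integral ?\<mu>A u" if v: "1-lipschitz_on UNIV v" for v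
    using order_trans[OF weak[OF v tr] cost_A] val_nonneg by (simp add: ennreal_le_iff)
  have "optimal_potential ?\<mu>A u"
    unfolding optimal_potential_def
  proof (intro conjI antisym)
    show "ereal (vector_integral ?\<mu>A u) \<le> (SUP v\<in>{v. 1-lipschitz_on UNIV v}. ereal (vector_integral ?\<mu>A v))"
      using lip by (intro SUP_upper) simp
    show "(SUP v\<in>{v. 1-lipschitz_on UNIV v}. ereal (vector_integral ?\<mu>A v)) \<le> ereal (vector_integral ?\<mu>A u)"
      using max by (intro SUP_least) simp
  qed (rule lip)
  thus ?thesis using \<mu>A0 tr opt_tr by simp
qed

end
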